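(* Let $p>p_{\mathrm F}(n)=1+2/n$, let $f$ satisfy the assumptions in the context, and let $\varepsilon_0>0$ be a constant with the property that for every $\psi\in L^1(\mathbb{R}^n)\cap L^\infty(\mathbb{R}^n)$ with $\|\psi\|_1+\|\psi\|_\infty\le\varepsilon_0$ the Cauchy problem (P) with initial data $\psi$ has a unique global solution $v\in X$, and this solution satisfies $\sup_{q\in[1,+\infty]}\sup_{t\ge0}(1+t)^{\frac n2(1-\frac1q)}\|v(t)\|_q<+\infty$. Let $\varphi\in L^1(\mathbb{R}^n)\cap L^\infty(\mathbb{R}^n)$ satisfy $\|\varphi\|_1+\|\varphi\|_\infty\le\varepsilon_0$, and let $u\in X$ be the global solution to (P) with initial data $\varphi$. Put $$\sigma:=\frac n2(p-1)-1>0,$$ and define recursively, for integers $N\ge1$, $$\varphi_1:=\varphi+\int_0^{+\infty}f(u(s))\,ds,\qquad u_1(t):=e^{t\Delta}\varphi_1,$$ $$\varphi_N:=\varphi+\int_0^{+\infty}\bigl(f(u(s))-f(u_{N-1}(s))\bigr)ds,\qquad u_N(t):=e^{t\Delta}\varphi_N+\int_0^te^{(t-s)\Delta}f(u_{N-1}(s))\,ds\qquad(N\ge2).$$ Then for any positive integer $N$ and any $q\in[1,+\infty]$ there exists $C_{N,q}>0$ such that, for all $t>2^{N-1}$, $$t^{\frac n2(1-\frac1q)}\|u(t)-u_N(t)\|_q\le\begin{cases}C_{N,q}\,t^{-N\sigma}&\text{if }0<N\sigma<1,\\ C_{N,q}\,t^{-1}\log(1+t)&\text{if }N\sigma=1,\\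 C_{N,q}\,t^{-1}&\text{if }N\sigma>1.\end{cases}$$
   Context: $n\ge1$ is an integer; $\|\cdot\|_q$ is the norm of $L^q(\mathbb{R}^n)$, all functions being real-valued. The nonlinearity $f:\mathbb{R}\to\mathbb{R}$ satisfies $f(0)=0$ and, for some constants $K>0$ and $p\in(1,+\infty)$, $|f(\xi)-f(\eta)|\le K(|\xi|^{p-1}+|\eta|^{p-1})|\xi-\eta|$ for all $\xi,\eta\in\mathbb{R}$. The Cauchy problem (P) is $\partial_t u-\Delta u=f(u)$ in $(0,+\infty)\times\mathbb{R}^n$, $u(0)=\varphi$. Heat semigroup: $e^{t\Delta}\varphi=G_t*\varphi$ for $t>0$ and $e^{0\Delta}\varphi=\varphi$, where $G_t(x)=(4\pi t)^{-n/2}\exp(-|x|^2/(4t))$. $X=(C\cap L^\infty)([0,+\infty);L^1(\mathbb{R}^n))\cap(C\cap L^\infty)((0,+\infty);L^\infty(\mathbb{R}^n))$ (bounded continuous functions of time in both senses). A global solution to (P) in $X$ means $u\in X$ satisfying the integral equation $u(t)=e^{t\Delta}\varphi+\int_0^te^{(t-s)\Delta}f(u(s))\,ds$ for all $t\ge0$. A constant $\varepsilon_0$ with the stated property exists whenever $p>1+2/n$. *)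

theory Defs
  imports "HOL-Analysis.Analysis" "HOL-Probability.Essential_Supremum"
begin

section \<open>The Banach space \<open>L\<^sup>1\<close>\<close>

text \<open>Real-valued integrable functions on a Euclidean space modulo equality almost everywhere.
  All functions of the space variable below are elements of this type, so that curves in
  \<open>L\<^sup>1\<close> can be integrated in time by the library's Bochner integral. The latter requires the
  classes \<^class>\<open>banach\<close> and \<^class>\<open>second_countable_topology\<close>, hence the proofs of
  completeness and separability.\<close>

definition L1_eq :: "('a::euclidean_space \<Rightarrow> real) \<Rightarrow> ('a \<Rightarrow> real) \<Rightarrow> bool"
  where "L1_eq f g \<longleftrightarrow> integrable lborel f \<and> integrable lborel g \<and> (AE x in lborel. f x = g x)"

lemma part_equivp_L1_eq: "part_equivp L1_eq"
proof (rule part_equivpI)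
  show "\<exists>f. L1_eq f f" by (rule exI[of _ "\<lambda>_. 0"]) (simp add: L1_eq_def)
  show "symp L1_eq" by (rule sympI) (auto simp: L1_eq_def)
  show "transp L1_eq" by (rule transpI) (auto simp: L1_eq_def elim: AE_mp)
qed

quotient_type (overloaded) 'a L1 = "'a::euclidean_space \<Rightarrow> real" / partial: L1_eq
  by (rule part_equivp_L1_eq)

subsection \<open>Normed space structure\<close>

instantiation L1 :: (euclidean_space) real_normed_vector
begin

lift_definition zero_L1 :: "'a L1" is "\<lambda>_. 0" by (simp add: L1_eq_def)

lift_definition plus_L1 :: "'a L1 \<Rightarrow> 'a L1 \<Rightarrow> 'a L1" is "\<lambda>f g x. f x + g x"
  by (auto simp: L1_eq_def)

lift_definition uminus_L1 :: "'a L1 \<Rightarrow> 'a L1" is "\<lambda>f x. - f x"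
  by (auto simp: L1_eq_def)

lift_definition minus_L1 :: "'a L1 \<Rightarrow> 'a L1 \<Rightarrow> 'a L1" is "\<lambda>f g x. f x - g x"
  by (auto simp: L1_eq_def)

lift_definition scaleR_L1 :: "real \<Rightarrow> 'a L1 \<Rightarrow> 'a L1" is "\<lambda>c f x. c * f x"
  by (auto simp: L1_eq_def)

lift_definition norm_L1 :: "'a L1 \<Rightarrow> real" is "\<lambda>f. LINT x|lborel. \<bar>f x\<bar>"
  by (auto simp: L1_eq_def intro!: integral_cong_AE)

definition dist_L1 :: "'a L1 \<Rightarrow> 'a L1 \<Rightarrow> real" where "dist_L1 f g = norm (f - g)"

definition uniformity_L1 :: "('a L1 \<times> 'a L1) filter"
  where "uniformity_L1 = (INF e\<in>{0<..}. principal {(x, y). dist x y < e})"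

definition open_L1 :: "'a L1 set \<Rightarrow> bool"
  where "open_L1 U = (\<forall>x\<in>U. eventually (\<lambda>(x', y). x' = x \<longrightarrow> y \<in> U) uniformity)"

definition sgn_L1 :: "'a L1 \<Rightarrow> 'a L1" where "sgn_L1 f = inverse (norm f) *\<^sub>R f"

instance
proof
  fix f g h :: "'a L1" and a b :: real and U :: "'a L1 set"
  show "f + g + h = f + (g + h)" by transfer (auto simp: L1_eq_def algebra_simps)
  show "f + g = g + f" by transfer (auto simp: L1_eq_def algebra_simps)
  show "0 + f = f" by transfer (auto simp: L1_eq_def)
  show "- f + f = 0" by transfer (auto simp: L1_eq_def)
  show "f - g = f + - g" by transfer (auto simp: L1_eq_def)
  show "a *\<^sub>R (f + g) = a *\<^sub>R f + a *\<^sub>R g" by transfer (auto simp: L1_eq_def algebra_simps)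
  show "(a + b) *\<^sub>R f = a *\<^sub>R f + b *\<^sub>R f" by transfer (auto simp: L1_eq_def algebra_simps)
  show "a *\<^sub>R b *\<^sub>R f = (a * b) *\<^sub>R f" by transfer (auto simp: L1_eq_def algebra_simps)
  show "1 *\<^sub>R f = f" by transfer (auto simp: L1_eq_def)
  show "dist f g = norm (f - g)" by (rule dist_L1_def)
  show "sgn f = inverse (norm f) *\<^sub>R f" by (rule sgn_L1_def)
  show "uniformity = (INF e\<in>{0<..}. principal {(x, y). dist x y < (e::real)} :: ('a L1 \<times> 'a L1) filter)"
    by (rule uniformity_L1_def)
  show "open U = (\<forall>x\<in>U. eventually (\<lambda>(x', y). x' = x \<longrightarrow> y \<in> U) uniformity)"
    by (rule open_L1_def)
  show "(norm f = 0) = (f = 0)"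
    by transfer (auto simp: L1_eq_def integral_nonneg_eq_0_iff_AE)
  show "norm (f + g) \<le> norm f + norm g"
  proof transfer
    fix f g :: "'a \<Rightarrow> real" assume "L1_eq f f" "L1_eq g g"
    then have "integrable lborel f" "integrable lborel g" by (auto simp: L1_eq_def)
    moreover from this have "(LINT x|lborel. \<bar>f x + g x\<bar>) \<le> (LINT x|lborel. \<bar>f x\<bar> + \<bar>g x\<bar>)"
      by (intro Bochner_Integration.integral_mono) auto
    ultimately show "(LINT x|lborel. \<bar>f x + g x\<bar>) \<le> (LINT x|lborel. \<bar>f x\<bar>) + (LINT x|lborel. \<bar>g x\<bar>)"
      by simp
  qed
  show "norm (a *\<^sub>R f) = \<bar>a\<bar> * norm f" by transfer (auto simp: L1_eq_def abs_mult)
qed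

end

lemma integrable_rep_L1: "integrable lborel (rep_L1 f)"
  using Quotient_rep_reflp[OF Quotient_L1, of f] by (simp add: L1_eq_def)

lemma abs_rep_L1: "abs_L1 (rep_L1 f) = f"
  by (rule Quotient_abs_rep[OF Quotient_L1])

lemma rep_abs_L1: "integrable lborel f \<Longrightarrow> AE x in lborel. rep_L1 (abs_L1 f) x = f x"
  using Quotient_rep_abs[OF Quotient_L1, of f] by (simp add: L1_eq_def)

lemma norm_abs_L1: "integrable lborel f \<Longrightarrow> norm (abs_L1 f) = (LINT x|lborel. \<bar>f x\<bar>)"
  by (simp add: norm_L1.abs_eq L1_eq_def)

lemma abs_L1_diff:
  "integrable lborel f \<Longrightarrow> integrable lborel g \<Longrightarrow> abs_L1 f - abs_L1 g = abs_L1 (\<lambda>x. f x - g x)"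
  by (simp add: minus_L1.abs_eq L1_eq_def)

lemma abs_L1_add:
  "integrable lborel f \<Longrightarrow> integrable lborel g \<Longrightarrow> abs_L1 f + abs_L1 g = abs_L1 (\<lambda>x. f x + g x)"
  by (simp add: plus_L1.abs_eq L1_eq_def)

lemma abs_L1_scaleR:
  "integrable lborel f \<Longrightarrow> c *\<^sub>R abs_L1 f = abs_L1 (\<lambda>x. c * f x)"
  by (simp add: scaleR_L1.abs_eq L1_eq_def)

lemma tendsto_abs_L1:
  fixes f w :: "'a::euclidean_space \<Rightarrow> real"
  assumes f: "integrable lborel f" and s: "\<And>i::nat. integrable lborel (s i)"
    and w: "integrable lborel w" and lim: "AE x in lborel. (\<lambda>i. s i x) \<longlonglongrightarrow> f x"
    and bd: "\<And>i. AE x in lborel. \<bar>s i x\<bar> \<le> w x"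
  shows "(\<lambda>i. abs_L1 (s i)) \<longlonglongrightarrow> abs_L1 f"
proof -
  have [measurable]: "f \<in> borel_measurable lborel" "\<And>i. s i \<in> borel_measurable lborel"
    using f s by auto
  have "(\<lambda>i. LINT x|lborel. \<bar>s i x - f x\<bar>) \<longlonglongrightarrow> (LINT (x::'a)|lborel. (0::real))"
  proof (rule integral_dominated_convergence[where w = "\<lambda>x. w x + \<bar>f x\<bar>"])
    show "AE x in lborel. (\<lambda>i. \<bar>s i x - f x\<bar>) \<longlonglongrightarrow> 0"
      using lim by eventually_elim (metis LIM_zero tendsto_rabs_zero_iff)
    show "AE x in lborel. norm \<bar>s i x - f x\<bar> \<le> w x + \<bar>f x\<bar>" for i
      using bd[of i] by eventually_elim auto
  qed (use f w in auto)
  then have "(\<lambda>i. norm (abs_L1 (s i) - abs_L1 f)) \<longlonglongrightarrow> 0"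
    using f s by (simp add: abs_L1_diff norm_abs_L1)
  then show ?thesis by (metis LIM_zero_cancel tendsto_norm_zero_iff)
qed

subsection \<open>Completeness\<close>

instance L1 :: (euclidean_space) banach
proof
  fix X :: "nat \<Rightarrow> 'a L1" assume "Cauchy X"
  have "\<exists>N. \<forall>m\<ge>N. \<forall>n\<ge>N. norm (X m - X n) < (1/2)^k" for k
    using CauchyD[OF \<open>Cauchy X\<close>, of "(1/2)^k"] by simp
  then obtain N where N: "\<And>k m n. m \<ge> N k \<Longrightarrow> n \<ge> N k \<Longrightarrow> norm (X m - X n) < (1/2)^k"
    by metis
  define r where "r k = k + sum N {..k}" for k
  have "N k \<le> r k" for k by (simp add: r_def member_le_sum trans_le_add2)
  have r: "strict_mono r" by (simp add: strict_mono_Suc_iff r_def)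
  have step: "norm (X (r (Suc k)) - X (r k)) < (1/2)^k" for k
    using \<open>N k \<le> r k\<close> r by (intro N) (meson le_trans lessI less_imp_le strict_mono_less)+
  define F where "F k = rep_L1 (X (r k))" for k
  have F[simp]: "integrable lborel (F k)" for k by (simp add: F_def integrable_rep_L1)
  then have [measurable]: "F k \<in> borel_measurable lborel" for k by blast
  have XF: "X (r k) = abs_L1 (F k)" for k by (simp add: F_def abs_rep_L1)
  define D where "D k x = F (Suc k) x - F k x" for k x
  have D[simp]: "integrable lborel (D k)" for k unfolding D_def by simp
  then have [measurable]: "D k \<in> borel_measurable lborel" for k by blast
  have nD: "(LINT x|lborel. \<bar>D k x\<bar>) \<le> (1/2)^k" for k
    using step[of k] by (simp add: XF abs_L1_diff norm_abs_L1 D_def)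
  have "(\<integral>\<^sup>+x. (\<Sum>k. ennreal \<bar>D k x\<bar>) \<partial>lborel) = (\<Sum>k. \<integral>\<^sup>+x. ennreal \<bar>D k x\<bar> \<partial>lborel)"
    by (rule nn_integral_suminf) simp
  also have "\<dots> \<le> (\<Sum>k. ennreal ((1/2)^k))"
    by (intro suminf_le) (auto simp: nn_integral_eq_integral nD ennreal_leI)
  also have "\<dots> = ennreal (\<Sum>k. (1/2)^k)"
    by (rule suminf_ennreal2) (auto intro: summable_geometric)
  also have "\<dots> < \<infinity>" by simp
  finally have "AE x in lborel. (\<Sum>k. ennreal \<bar>D k x\<bar>) \<noteq> \<infinity>"
    by (intro nn_integral_noteq_infinite) auto
  then have sD: "AE x in lborel. summable (\<lambda>k. \<bar>D k x\<bar>)"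
    by eventually_elim (auto intro: summable_suminf_not_top)
  have sI: "summable (\<lambda>k. LINT x|lborel. \<bar>D k x\<bar>)"
    by (rule summable_comparison_test'[of "\<lambda>k. (1/2)^k" 0])
       (auto simp: nD intro: summable_geometric)
  have W: "integrable lborel (\<lambda>x. \<Sum>k. \<bar>D k x\<bar>)" 
    by (rule integrable_suminf) (use sD sI in auto)
  have S: "integrable lborel (\<lambda>x. \<Sum>k. D k x)"
    by (rule integrable_suminf) (use sD sI in auto)
  have FS: "F n x = F 0 x + (\<Sum>k<n. D k x)" for n x
    using sum_lessThan_telescope[of "\<lambda>k. F k x" n] by (simp add: D_def)
  have "(\<lambda>n. abs_L1 (F n)) \<longlonglongrightarrow> abs_L1 (\<lambda>x. F 0 x + (\<Sum>k. D k x))"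
  proof (rule tendsto_abs_L1)
    show "AE x in lborel. (\<lambda>n. F n x) \<longlonglongrightarrow> F 0 x + (\<Sum>k. D k x)"
      using sD
    proof eventually_elim
      fix x assume "summable (\<lambda>k. \<bar>D k x\<bar>)"
      then have "(\<lambda>n. \<Sum>k<n. D k x) \<longlonglongrightarrow> (\<Sum>k. D k x)"
        by (rule summable_LIMSEQ[OF summable_rabs_cancel])
      then have "(\<lambda>n. F 0 x + (\<Sum>k<n. D k x)) \<longlonglongrightarrow> F 0 x + (\<Sum>k. D k x)"
        by (rule tendsto_add[OF tendsto_const])
      then show "(\<lambda>n. F n x) \<longlonglongrightarrow> F 0 x + (\<Sum>k. D k x)"
        by (rule Lim_transform_eventually) (rule always_eventually, rule allI, rule FS[symmetric])
    qed
    show "AE x in lborel. \<bar>F n x\<bar> \<le> \<bar>F 0 x\<bar> + (\<Sum>k. \<bar>D k x\<bar>)" for n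
      using sD
    proof eventually_elim
      fix x assume s: "summable (\<lambda>k. \<bar>D k x\<bar>)"
      have "\<bar>\<Sum>k<n. D k x\<bar> \<le> (\<Sum>k<n. \<bar>D k x\<bar>)" by (rule sum_abs)
      also have "\<dots> \<le> (\<Sum>k. \<bar>D k x\<bar>)" by (rule sum_le_suminf[OF s]) auto
      finally show "\<bar>F n x\<bar> \<le> \<bar>F 0 x\<bar> + (\<Sum>k. \<bar>D k x\<bar>)" using FS[of n x] by linarith
    qed
  qed (use W S in auto)
  then have "(X \<circ> r) \<longlonglongrightarrow> abs_L1 (\<lambda>x. F 0 x + (\<Sum>k. D k x))"
    by (simp add: XF o_def)
  then show "convergent X"
    using Cauchy_converges_subseq \<open>Cauchy X\<close> r unfolding convergent_def by blast
qed
subsection \<open>Separability\<close>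

definition rational_boxes :: "'a::euclidean_space set set"
  where "rational_boxes =
    (\<lambda>f. box (\<Sum>i\<in>Basis. fst (f i) *\<^sub>R i) (\<Sum>i\<in>Basis. snd (f i) *\<^sub>R i)) ` (Basis \<rightarrow>\<^sub>E \<rat> \<times> \<rat>)"

lemma countable_rational_boxes: "countable rational_boxes"
  unfolding rational_boxes_def by (intro countable_image countable_PiE) (auto simp: countable_rat)

lemma rational_boxes_cover:
  fixes U :: "'a::euclidean_space set"
  assumes "open U"
  shows "U = \<Union>{B \<in> rational_boxes. B \<subseteq> U}"
  using open_UNION_box[OF assms] unfolding rational_boxes_def by blast

lemma rational_boxes_finite_Un:
  fixes B :: "'a::euclidean_space set set"
  assumes "finite B" "B \<subseteq> rational_boxes"
  shows "\<Union>B \<in> sets lborel" "emeasure lborel (\<Union>B) < \<infinity>"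
proof -
  have *: "\<exists>a b. X = box a b" if "X \<in> B" for X
    using that assms(2) unfolding rational_boxes_def by blast
  then show "\<Union>B \<in> sets lborel"
    by (metis borel_open open_Union open_box sets_lborel)
  have "bounded (\<Union>B)"
    using * assms(1) by (metis bounded_Union bounded_box)
  then show "emeasure lborel (\<Union>B) < \<infinity>"
    by (rule emeasure_bounded_finite)
qed

definition L1_steps :: "'a::euclidean_space L1 set"
  where "L1_steps = (\<lambda>xs. sum_list (map (\<lambda>(q, B). q *\<^sub>R abs_L1 (indicator (\<Union>B))) xs)) `
    lists (\<rat> \<times> {B. finite B \<and> B \<subseteq> rational_boxes})"

lemma countable_L1_steps: "countable L1_steps"
  unfolding L1_steps_def
  by (intro countable_image countable_lists countable_SIGMA countable_rat
      countable_Collect_finite_subset countable_rational_boxes)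

lemma L1_steps_add: "f \<in> L1_steps \<Longrightarrow> g \<in> L1_steps \<Longrightarrow> f + g \<in> L1_steps"
  unfolding L1_steps_def
proof (elim imageE)
  fix xs ys
  assume *: "xs \<in> lists (\<rat> \<times> {B. finite B \<and> B \<subseteq> rational_boxes})"
    "ys \<in> lists (\<rat> \<times> {B. finite B \<and> B \<subseteq> rational_boxes})"
    "f = sum_list (map (\<lambda>(q, B). q *\<^sub>R abs_L1 (indicator (\<Union>B))) xs)"
    "g = sum_list (map (\<lambda>(q, B). q *\<^sub>R abs_L1 (indicator (\<Union>B))) ys)"
  show "f + g \<in> (\<lambda>xs. sum_list (map (\<lambda>(q, B). q *\<^sub>R abs_L1 (indicator (\<Union>B))) xs)) `
      lists (\<rat> \<times> {B. finite B \<and> B \<subseteq> rational_boxes})"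
    by (rule image_eqI[of _ _ "xs @ ys"]) (use * in auto)
qed

lemma closure_L1_steps_add:
  assumes "f \<in> closure L1_steps" "g \<in> closure L1_steps"
  shows "f + g \<in> closure L1_steps"
proof -
  obtain s t where "\<And>n. s n \<in> L1_steps" "s \<longlonglongrightarrow> f" "\<And>n. t n \<in> L1_steps" "t \<longlonglongrightarrow> g"
    using assms by (auto simp: closure_sequential)
  then show ?thesis
    unfolding closure_sequential
    by (intro exI[of _ "\<lambda>n. s n + t n"]) (auto intro: L1_steps_add tendsto_add)
qed

lemma closure_L1_steps_limit:
  assumes "\<And>n::nat. s n \<in> closure L1_steps" "s \<longlonglongrightarrow> f"
  shows "f \<in> closure L1_steps"
  by (rule closed_sequentially[OF closed_closure assms])

lemma closure_L1_steps_open: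
  fixes U :: "'a::euclidean_space set"
  assumes "open U" "emeasure lborel U < \<infinity>"
  shows "c *\<^sub>R abs_L1 (indicator U) \<in> closure L1_steps"
proof -
  have box: "c *\<^sub>R abs_L1 (indicator (\<Union>B)) \<in> closure L1_steps"
    if B: "finite B" "B \<subseteq> rational_boxes" for B :: "'a set set"
  proof -
    have "\<exists>y\<in>\<rat>. dist y c < e" if "e > 0" for e
      using Rats_dense_in_real[of c "c + e"] that by (force simp: dist_real_def)
    then have "c \<in> closure \<rat>" by (simp add: closure_approachable)
    then obtain q where q: "\<And>n. q n \<in> \<rat>" "q \<longlonglongrightarrow> c" by (auto simp: closure_sequential)
    have "q n *\<^sub>R abs_L1 (indicator (\<Union>B)) \<in> L1_steps" for n
      unfolding L1_steps_def by (rule image_eqI[of _ _ "[(q n, B)]"]) (use q B in auto)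
    moreover have "(\<lambda>n. q n *\<^sub>R abs_L1 (indicator (\<Union>B))) \<longlonglongrightarrow> c *\<^sub>R abs_L1 (indicator (\<Union>B))"
      by (intro tendsto_intros q)
    ultimately show ?thesis unfolding closure_sequential by (intro exI conjI allI)
  qed
  show ?thesis
  proof (cases "U = {}")
    case True
    then show ?thesis using box[of "{}"] by simp
  next
    case False
    define \<B> where "\<B> = {B \<in> rational_boxes. B \<subseteq> U}"
    have U: "U = \<Union>\<B>" unfolding \<B>_def by (rule rational_boxes_cover[OF assms(1)])
    have "countable \<B>" "\<B> \<noteq> {}"
      using U False countable_subset[OF _ countable_rational_boxes, of \<B>] by (auto simp: \<B>_def)
    then have \<B>: "\<B> = range (from_nat_into \<B>)" by simp
    define V where "V n = \<Union>(from_nat_into \<B> ` {..n::nat})" for n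
    have V: "c *\<^sub>R abs_L1 (indicator (V n)) \<in> closure L1_steps" for n
      unfolding V_def using \<B> by (intro box) (auto simp: \<B>_def)
    have VU: "V n \<subseteq> U" for n unfolding V_def using U \<B> by blast
    have Vs: "V n \<in> sets lborel" "emeasure lborel (V n) < \<infinity>" for n
      unfolding V_def using \<B> by (intro rational_boxes_finite_Un; auto simp: \<B>_def)+
    have Us: "U \<in> sets lborel" using assms by simp
    have "(\<lambda>n. abs_L1 (indicator (V n))) \<longlonglongrightarrow> abs_L1 (indicator U)"
    proof (rule tendsto_abs_L1[where w = "indicator U"])
      show "AE x in lborel. (\<lambda>n. indicator (V n) x :: real) \<longlonglongrightarrow> indicator U x"
      proof (rule AE_I2)
        fix x :: 'a
        have "eventually (\<lambda>n. (indicator (V n) x :: real) = indicator U x) sequentially"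
        proof (cases "x \<in> U")
          case True
          then obtain m where "x \<in> from_nat_into \<B> m" using U \<B> by blast
          then have "x \<in> V n" if "n \<ge> m" for n using that by (auto simp: V_def)
          then have "(indicator (V n) x :: real) = indicator U x" if "n \<ge> m" for n
            using True that by simp
          then show ?thesis unfolding eventually_sequentially by blast
        next
          case False
          then have "x \<notin> V n" for n using VU by blast
          then show ?thesis using False by simp
        qed
        then show "(\<lambda>n. indicator (V n) x :: real) \<longlonglongrightarrow> indicator U x"
          by (rule tendsto_eventually)
      qed
      show "AE x in lborel. \<bar>indicator (V n) x\<bar> \<le> (indicator U x :: real)" for n
        using VU[of n] by (auto simp: indicator_def)
    qed (intro integrable_real_indicator Us Vs assms(2))+
    then have "(\<lambda>n. c *\<^sub>R abs_L1 (indicator (V n))) \<longlonglongrightarrow> c *\<^sub>R abs_L1 (indicator U)"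
      by (intro tendsto_intros)
    then show ?thesis by (rule closure_L1_steps_limit[OF V])
  qed
qed

lemma closure_L1_steps_indicator:
  fixes A :: "'a::euclidean_space set"
  assumes A: "A \<in> sets lborel" "emeasure lborel A < \<infinity>"
  shows "c *\<^sub>R abs_L1 (indicator A) \<in> closure L1_steps"
proof -
  have "\<exists>U. open U \<and> A \<subseteq> U \<and> emeasure lborel (U - A) < ennreal (inverse (Suc n))" for n
    using outer_regular_lborel[of A "inverse (Suc n)"] A by (metis inverse_positive_iff_positive of_nat_0_less_iff sets_lborel zero_less_Suc)
  then obtain U where U: "\<And>n. open (U n)" "\<And>n. A \<subseteq> U n"
      "\<And>n. emeasure lborel (U n - A) < ennreal (inverse (Suc n))"
    by metis
  have Us: "U n \<in> sets lborel" "U n - A \<in> sets lborel" for n using U(1) A by auto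
  have fin: "emeasure lborel (U n) < \<infinity>" for n
  proof -
    have "emeasure lborel (U n) = emeasure lborel A + emeasure lborel (U n - A)"
      using A Us U(2)[of n] by (subst plus_emeasure) (auto simp: Un_absorb1)
    also have "\<dots> < \<infinity>"
      using A(2) U(3)[of n] by (simp add: less_top[symmetric]) (metis ennreal_less_top less_trans top.not_eq_extremum)
    finally show ?thesis .
  qed
  have fin': "emeasure lborel (U n - A) < \<infinity>" for n
    using U(3)[of n] by (metis ennreal_less_top infinity_ennreal_def less_trans)
  have "norm (abs_L1 (indicator (U n)) - abs_L1 (indicator A)) \<le> inverse (Suc n)" for n
  proof -
    have "abs_L1 (indicator (U n)) - abs_L1 (indicator A) = abs_L1 (indicator (U n - A) :: 'a \<Rightarrow> real)"
    proof -
      have "(indicator (U n - A) :: 'a \<Rightarrow> real) = (\<lambda>x. indicator (U n) x - indicator A x)"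
        using U(2)[of n] by (auto simp: indicator_def fun_eq_iff)
      then show ?thesis using A Us fin by (simp add: abs_L1_diff)
    qed
    then have "norm (abs_L1 (indicator (U n)) - abs_L1 (indicator A)) = measure lborel (U n - A)"
      using Us fin'[of n] by (simp add: norm_abs_L1)
    also have "\<dots> \<le> inverse (Suc n)"
      using U(3)[of n] by (auto simp: measure_def intro!: enn2real_leI)
    finally show ?thesis .
  qed
  then have "(\<lambda>n. abs_L1 (indicator (U n)) - abs_L1 (indicator A)) \<longlonglongrightarrow> 0"
    by (intro Lim_null_comparison[OF _ LIMSEQ_inverse_real_of_nat]) auto
  then have "(\<lambda>n. c *\<^sub>R abs_L1 (indicator (U n))) \<longlonglongrightarrow> c *\<^sub>R abs_L1 (indicator A)"
    by (intro tendsto_intros) (simp add: LIM_zero_iff)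
  then show ?thesis
    by (rule closure_L1_steps_limit[rotated]) (intro closure_L1_steps_open U fin)
qed

lemma closure_L1_steps: "closure L1_steps = (UNIV :: 'a::euclidean_space L1 set)"
proof -
  have "abs_L1 f \<in> closure L1_steps" if "integrable lborel f" for f :: "'a \<Rightarrow> real"
    using that
  proof (induction f rule: integrable_induct)
    case (base A c)
    then have "abs_L1 (\<lambda>x. indicator A x *\<^sub>R c) = c *\<^sub>R abs_L1 (indicator A)"
      by (subst abs_L1_scaleR) (auto simp: mult.commute)
    then show ?case using closure_L1_steps_indicator base by metis
  next
    case (add f g)
    then show ?case by (metis abs_L1_add closure_L1_steps_add)
  next
    case (lim f s)
    have "(\<lambda>i. abs_L1 (s i)) \<longlonglongrightarrow> abs_L1 f"
      using lim by (intro tendsto_abs_L1[where w = "\<lambda>x. 2 * \<bar>f x\<bar>"]) auto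
    then show ?case using lim closure_L1_steps_limit by metis
  qed
  then have "f \<in> closure L1_steps" for f :: "'a L1"
    by (metis abs_rep_L1 integrable_rep_L1)
  then show ?thesis by auto
qed

instance L1 :: (euclidean_space) second_countable_topology
proof
  define \<B> where "\<B> = (\<lambda>(f :: 'a L1, q). ball f q) ` (L1_steps \<times> (\<rat> :: real set))"
  have "countable \<B>"
    unfolding \<B>_def by (intro countable_image countable_SIGMA countable_L1_steps countable_rat)
  moreover have "topological_basis \<B>"
  proof (rule topological_basisI)
    show "open B" if "B \<in> \<B>" for B using that by (auto simp: \<B>_def)
    fix S and f :: "'a L1" assume "open S" "f \<in> S"
    then obtain e where e: "e > 0" "ball f e \<subseteq> S" by (auto simp: open_contains_ball)
    obtain q where q: "q \<in> \<rat>" "0 < q" "q < e / 2"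
      using Rats_dense_in_real[of 0 "e / 2"] e(1) by auto
    obtain g where g: "g \<in> L1_steps" "dist g f < q"
      using closure_L1_steps q(2) by (metis UNIV_I closure_approachable)
    show "\<exists>B\<in>\<B>. f \<in> B \<and> B \<subseteq> S"
    proof (intro bexI[of _ "ball g q"] conjI)
      show "f \<in> ball g q" using g by simp
      have "ball g q \<subseteq> ball f e"
      proof
        fix h assume "h \<in> ball g q"
        then have "dist f h < q + q"
          using g dist_triangle[of f h g] by (simp add: dist_commute)
        then show "h \<in> ball f e" using q by simp
      qed
      then show "ball g q \<subseteq> S" using e by blast
      show "ball g q \<in> \<B>" unfolding \<B>_def using g q by auto
    qed
  qed
  ultimately show "\<exists>B :: 'a L1 set set. countable B \<and> open = generate_topology B"
    using topological_basis_imp_subbasis by blast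
qed

section \<open>\<open>L\<^sup>q\<close> norms\<close>

text \<open>The exponent \<open>q \<in> [1, \<infinity>]\<close> has type \<^typ>\<open>ennreal\<close>, so that \<open>1 / q\<close> is
  \<open>enn2real (inverse q)\<close>, with value \<open>0\<close> at \<open>q = \<infinity>\<close>. The norm is \<open>\<infinity>\<close> for functions outside
  \<open>L\<^sup>q\<close>.\<close>

definition Lq_norm :: "ennreal \<Rightarrow> 'a::euclidean_space L1 \<Rightarrow> ennreal"
  where "Lq_norm q g =
    (if q = \<infinity> then esssup lborel (\<lambda>x. ennreal \<bar>rep_L1 g x\<bar>)
     else let r = enn2real q; I = (\<integral>\<^sup>+x. ennreal (\<bar>rep_L1 g x\<bar> powr r) \<partial>lborel)
          in if I = \<infinity> then \<infinity> else ennreal (enn2real I powr (1 / r)))"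

lemma Lq_norm_1: "Lq_norm 1 g = ennreal (norm g)"
proof -
  have "norm g = (LINT x|lborel. \<bar>rep_L1 g x\<bar>)"
    using norm_abs_L1[OF integrable_rep_L1[of g]] by (simp add: abs_rep_L1)
  moreover have "(\<integral>\<^sup>+x. ennreal \<bar>rep_L1 g x\<bar> \<partial>lborel) = ennreal (LINT x|lborel. \<bar>rep_L1 g x\<bar>)"
    by (rule nn_integral_eq_integral) (auto intro: integrable_rep_L1)
  ultimately show ?thesis by (simp add: Lq_norm_def Let_def)
qed

section \<open>Heat semigroup and Nemytskii operator\<close>

text \<open>The class of an integrable function; the value \<open>0\<close> for non-integrable functions is
  a convention.\<close>

definition to_L1 :: "('a::euclidean_space \<Rightarrow> real) \<Rightarrow> 'a L1"
  where "to_L1 h = (if integrable lborel h then abs_L1 h else 0)"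

definition heat_kernel :: "real \<Rightarrow> 'a::euclidean_space \<Rightarrow> real"
  where "heat_kernel t x = (4 * pi * t) powr (- (DIM('a) / 2)) * exp (- (norm x)\<^sup>2 / (4 * t))"

text \<open>Only used for \<^prop>\<open>t \<ge> (0::real)\<close>.\<close>

definition heat :: "real \<Rightarrow> 'a::euclidean_space L1 \<Rightarrow> 'a L1"
  where "heat t g =
    (if t > 0 then to_L1 (\<lambda>x. LINT y|lborel. heat_kernel t (x - y) * rep_L1 g y) else g)"

text \<open>For \<open>f\<close> as in the theorem, \<open>f \<circ> g\<close> is integrable whenever
  \<open>g \<in> L\<^sup>1 \<inter> L\<^sup>\<infinity>\<close>.\<close>

definition nemytskii :: "(real \<Rightarrow> real) \<Rightarrow> 'a::euclidean_space L1 \<Rightarrow> 'a L1"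
  where "nemytskii f g = to_L1 (\<lambda>x. f (rep_L1 g x))"

section \<open>The Cauchy problem\<close>

text \<open>\<open>X = (C \<inter> L\<^sup>\<infinity>)([0,\<infinity>); L\<^sup>1) \<inter> (C \<inter> L\<^sup>\<infinity>)((0,\<infinity>); L\<^sup>\<infinity>)\<close>. Curves are total functions on
  \<^typ>\<open>real\<close>, whose values at negative times are never used; continuity into \<open>L\<^sup>1\<close> refers to the norm of
  the type \<open>L1\<close>, which is the \<open>L\<^sup>1\<close> norm.\<close>

definition space_X :: "(real \<Rightarrow> 'a::euclidean_space L1) set"
  where "space_X = {u.
    continuous_on {0..} u \<and> bounded (u ` {0..}) \<and>
    (\<forall>t>0. ((\<lambda>s. Lq_norm \<infinity> (u s - u t)) \<longlongrightarrow> 0) (at t within {0<..})) \<and>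
    (\<exists>M::real. \<forall>t>0. Lq_norm \<infinity> (u t) \<le> ennreal M)}"

definition global_solution ::
    "(real \<Rightarrow> real) \<Rightarrow> 'a::euclidean_space L1 \<Rightarrow> (real \<Rightarrow> 'a L1) \<Rightarrow> bool"
  where "global_solution f \<psi> u \<longleftrightarrow> u \<in> space_X \<and>
    (\<forall>t\<ge>0. u t = heat t \<psi> + (LINT s:{0..t}|lborel. heat (t - s) (nemytskii f (u s))))"

end

theory Submission
  imports Defs "HOL-Probability.Distributions"
begin

text \<open>With \<open>U 0 = 0\<close> and \<open>h = f(u) - f(U N)\<close> one has
  \<open>u(t) - U (N + 1) t = \<integral>\<^sub>0\<^sup>t e\<^bsup>(t-s)\<Delta>\<^esup> h(s) ds - e\<^bsup>t\<Delta>\<^esup> \<integral>\<^sub>0\<^sup>\<infinity> h(s) ds\<close> for every \<open>N\<close>, so a single linear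
  estimate drives an induction on \<open>N\<close>. If \<open>h(s)\<close> is \<open>O((1 + s)\<^bsup>-1-a\<^esup>)\<close> in \<open>L\<^sup>1\<close> and
  \<open>O((1 + s)\<^bsup>-1-a-n/2\<^esup>)\<close> in \<open>L\<^sup>\<infinity>\<close>, the contribution of time \<open>s\<close> to the right-hand side is bounded by
  \<open>min 1 (s / t) (1 + s)\<^bsup>-1-a\<^esup>\<close> in \<open>L\<^sup>1\<close> and by \<open>t\<^bsup>-n/2\<^esup>\<close> times this in \<open>L\<^sup>\<infinity>\<close>, because the heat kernels at
  times \<open>t - s\<close> and \<open>t\<close> differ by at most \<open>O(s / t)\<close> times the kernel at time \<open>2t\<close> when \<open>s \<le> t / 2\<close>.
  The time integral decays like \<open>t\<^bsup>-a\<^esup>\<close>, \<open>t\<^bsup>-1\<^esup> log (1 + t)\<close> or \<open>t\<^bsup>-1\<^esup>\<close> according to the position of \<open>a\<close>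
  relative to \<open>1\<close>. The Lipschitz bound on \<open>f\<close> and the decay of \<open>u\<close> turn a decay of order \<open>b\<close> of
  \<open>u - U N\<close> into such a bound on \<open>h\<close> with \<open>a = \<sigma> + b\<close>. The remaining exponents follow by interpolation.\<close>

section \<open>Functions in \<open>L\<^sup>1\<close> and their representatives\<close>

lemma measurable_rep_L1 [measurable]: "rep_L1 g \<in> borel_measurable lborel"
  using integrable_rep_L1 by blast

lemma rep_L1_zero: "AE x in lborel. rep_L1 0 x = 0"
  using rep_abs_L1[of "\<lambda>_. 0"] by (simp add: zero_L1_def)

lemma rep_L1_add: "AE x in lborel. rep_L1 (g + h) x = rep_L1 g x + rep_L1 h x"
  using abs_L1_add[OF integrable_rep_L1 integrable_rep_L1, of g h]
    rep_abs_L1[OF Bochner_Integration.integrable_add[OF integrable_rep_L1 integrable_rep_L1], of g h]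
  by (simp add: abs_rep_L1)

lemma rep_L1_diff: "AE x in lborel. rep_L1 (g - h) x = rep_L1 g x - rep_L1 h x"
  using abs_L1_diff[OF integrable_rep_L1 integrable_rep_L1, of g h]
    rep_abs_L1[OF Bochner_Integration.integrable_diff[OF integrable_rep_L1 integrable_rep_L1], of g h]
  by (simp add: abs_rep_L1)

lemma rep_L1_scaleR: "AE x in lborel. rep_L1 (c *\<^sub>R g) x = c * rep_L1 g x"
  using abs_L1_scaleR[OF integrable_rep_L1, of c g]
    rep_abs_L1[OF integrable_mult_right[OF integrable_rep_L1], of c g]
  by (simp add: abs_rep_L1)

lemma norm_L1_rep: "norm g = (LINT x|lborel. \<bar>rep_L1 g x\<bar>)"
  using norm_abs_L1[OF integrable_rep_L1[of g]] by (simp add: abs_rep_L1)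

lemma norm_L1_le_mult:
  assumes "AE x in lborel. \<bar>rep_L1 g x\<bar> \<le> L * \<bar>rep_L1 h x\<bar>"
  shows "norm g \<le> L * norm h"
proof -
  have "(LINT x|lborel. \<bar>rep_L1 g x\<bar>) \<le> (LINT x|lborel. L * \<bar>rep_L1 h x\<bar>)"
    using assms by (intro integral_mono_AE) (auto simp: integrable_rep_L1)
  then show ?thesis by (simp add: norm_L1_rep)
qed

section \<open>Essential bounds\<close>

text \<open>A real bound in place of the extended norm \<open>Lq_norm \<infinity>\<close>, so that
  later estimates are inequalities between reals; \<open>Lq_norm_infinity_le_iff\<close> links the
  two.\<close>

definition Linf_le :: "'a::euclidean_space L1 \<Rightarrow> real \<Rightarrow> bool"
  where "Linf_le g M \<longleftrightarrow> (AE x in lborel. \<bar>rep_L1 g x\<bar> \<le> M)"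

text \<open>Lebesgue measure is not the zero measure, so a negative bound on an absolute value
  cannot hold almost everywhere.\<close>

lemma Linf_le_nonneg:
  assumes "Linf_le (g :: 'a::euclidean_space L1) M"
  shows "0 \<le> M"
proof (rule ccontr)
  assume "\<not> 0 \<le> M"
  with assms have "AE x in (lborel :: 'a measure). False"
    unfolding Linf_le_def by (auto elim!: eventually_mono)
  then have "ae_filter (lborel :: 'a measure) = bot" by (simp add: eventually_False)
  then show False by (simp add: ae_filter_eq_bot_iff)
qed

lemma Linf_le_mono: "Linf_le g M \<Longrightarrow> M \<le> N \<Longrightarrow> Linf_le g N"
  unfolding Linf_le_def by (erule eventually_mono) auto

lemma Linf_le_zero: "Linf_le 0 0"
  unfolding Linf_le_def using rep_L1_zero by eventually_elim auto

lemma Linf_le_diff: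
  assumes "Linf_le g M" "Linf_le h N"
  shows "Linf_le (g - h) (M + N)"
  using assms rep_L1_diff[of g h] unfolding Linf_le_def by eventually_elim auto

lemma Linf_le_mult:
  assumes "AE x in lborel. \<bar>rep_L1 g x\<bar> \<le> L * \<bar>rep_L1 h x\<bar>" "Linf_le h M" "L \<ge> 0"
  shows "Linf_le g (L * M)"
  using assms(1,2) unfolding Linf_le_def
proof eventually_elim
  case (elim x)
  then show ?case using mult_left_mono[OF elim(2) assms(3)] by linarith
qed

lemma Lq_norm_infinity_le_iff:
  assumes "M \<ge> 0"
  shows "Lq_norm \<infinity> g \<le> ennreal M \<longleftrightarrow> Linf_le g M"
proof
  assume *: "Lq_norm \<infinity> g \<le> ennreal M"
  have "AE x in lborel. ennreal \<bar>rep_L1 g x\<bar> \<le> Lq_norm \<infinity> g"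
    using esssup_AE[of "\<lambda>x. ennreal \<bar>rep_L1 g x\<bar>" lborel] by (simp add: Lq_norm_def)
  then show "Linf_le g M"
    unfolding Linf_le_def
  proof eventually_elim
    case (elim x)
    then have "ennreal \<bar>rep_L1 g x\<bar> \<le> ennreal M" using * by order
    then show ?case using assms by simp
  qed
next
  assume "Linf_le g M"
  then have "AE x in lborel. ennreal \<bar>rep_L1 g x\<bar> \<le> ennreal M"
    unfolding Linf_le_def by eventually_elim (auto intro: ennreal_leI)
  then show "Lq_norm \<infinity> g \<le> ennreal M"
    unfolding Lq_norm_def by (auto intro!: esssup_I)
qed

text \<open>For finite \<open>q = r\<close> one integrates
  \<open>\<bar>g\<bar> powr r \<le> M powr (r - 1) * \<bar>g\<bar>\<close> and takes the root of
  order \<open>r\<close>.\<close>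

lemma Lq_norm_interpolation:
  assumes q: "q \<ge> 1" and A: "norm g \<le> A" and M: "Linf_le g M"
  shows "Lq_norm q g \<le> ennreal (A powr enn2real (inverse q) * M powr (1 - enn2real (inverse q)))"
proof (cases "q = \<infinity>")
  case True
  have "Lq_norm \<infinity> g \<le> ennreal M" using M Linf_le_nonneg[OF M] Lq_norm_infinity_le_iff by blast
  \<comment> \<open>Since \<open>0 powr 0 = 0\<close>, the claimed bound at
    \<open>q = \<infinity>\<close> is \<open>M\<close> for \<open>A > 0\<close> but \<open>0\<close>
    for \<open>A = 0\<close>; in the second case \<open>g\<close> itself is zero.\<close>
  moreover have "A > 0 \<or> A = 0" using A norm_ge_zero[of g] by linarith
  moreover have "Linf_le g 0" if "A = 0"
    using that A Linf_le_zero by auto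
  then have "A = 0 \<Longrightarrow> Lq_norm \<infinity> g \<le> ennreal 0" using Lq_norm_infinity_le_iff by blast
  ultimately show ?thesis using True Linf_le_nonneg[OF M] by auto
next
  case False
  define r where "r = enn2real q"
  have qr: "q = ennreal r" using False by (simp add: r_def less_top)
  then have r: "r \<ge> 1" using q by (metis ennreal_1 ennreal_le_iff enn2real_nonneg r_def)
  have inv: "enn2real (inverse q) = 1 / r"
    using r qr by (simp add: inverse_ennreal inverse_eq_divide)
  have M0: "M \<ge> 0" by (rule Linf_le_nonneg[OF M])
  define I where "I = (\<integral>\<^sup>+x. ennreal (\<bar>rep_L1 g x\<bar> powr r) \<partial>lborel)"
  have "I \<le> (\<integral>\<^sup>+x. ennreal (M powr (r - 1) * \<bar>rep_L1 g x\<bar>) \<partial>lborel)"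
    unfolding I_def
  proof (rule nn_integral_mono_AE, rule eventually_mono[OF M[unfolded Linf_le_def]])
    fix x assume elim: "\<bar>rep_L1 g x\<bar> \<le> M"
    show "ennreal (\<bar>rep_L1 g x\<bar> powr r) \<le> ennreal (M powr (r - 1) * \<bar>rep_L1 g x\<bar>)"
    proof (cases "rep_L1 g x = 0")
      case False
      then have "\<bar>rep_L1 g x\<bar> powr r = \<bar>rep_L1 g x\<bar> powr (r - 1) * \<bar>rep_L1 g x\<bar>"
        using powr_mult_base[of "\<bar>rep_L1 g x\<bar>" "r - 1"] by (simp add: mult.commute)
      also have "\<dots> \<le> M powr (r - 1) * \<bar>rep_L1 g x\<bar>"
        using elim r by (intro mult_right_mono powr_mono2) auto
      finally show ?thesis by (rule ennreal_leI)
    qed simp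
  qed
  also have "\<dots> = ennreal (M powr (r - 1) * norm g)"
    unfolding norm_L1_rep by (subst nn_integral_eq_integral) (auto simp: integrable_rep_L1)
  also have "\<dots> \<le> ennreal (M powr (r - 1) * A)"
    using A by (intro ennreal_leI mult_left_mono) auto
  finally have I: "I \<le> ennreal (M powr (r - 1) * A)" .
  have A0: "A \<ge> 0" using A norm_ge_zero[of g] by linarith
  have "I \<noteq> \<infinity>" using I by (auto simp: top_unique)
  then have "Lq_norm q g = ennreal (enn2real I powr (1 / r))"
    using False by (simp add: Lq_norm_def Let_def r_def I_def)
  also have "\<dots> \<le> ennreal ((M powr (r - 1) * A) powr (1 / r))"
    using I A0 r by (intro ennreal_leI powr_mono2 enn2real_leI) auto
  also have "(M powr (r - 1) * A) powr (1 / r) = A powr (1 / r) * M powr (1 - 1 / r)"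
    using A0 M0 r by (simp add: powr_mult powr_powr field_simps)
  finally show ?thesis by (simp add: inv)
qed

section \<open>Essential bounds of Bochner integrals by duality\<close>

text \<open>These functionals stand in for point evaluation, which makes no sense on classes of
  functions: being continuous on L^1, they commute with Bochner integrals.\<close>

lemma bounded_linear_set_integral_rep:
  assumes [measurable]: "A \<in> sets lborel"
  shows "bounded_linear (\<lambda>g::'a::euclidean_space L1. LINT x:A|lborel. rep_L1 g x)"
proof -
  have int: "set_integrable lborel A (rep_L1 g)" for g :: "'a L1"
    unfolding set_integrable_def by (rule integrable_mult_indicator[OF assms integrable_rep_L1])
  have [measurable]: "set_borel_measurable lborel A (rep_L1 g)" for g :: "'a L1"
    unfolding set_borel_measurable_def by measurable
  show ?thesis
  proof (rule bounded_linear_intro[where K = 1])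
    fix g h :: "'a L1" and c :: real
    have "(LINT x:A|lborel. rep_L1 (g + h) x) = (LINT x:A|lborel. rep_L1 g x + rep_L1 h x)"
      unfolding set_lebesgue_integral_def using rep_L1_add[of g h]
      by (intro integral_cong_AE) (auto elim!: eventually_mono)
    then show "(LINT x:A|lborel. rep_L1 (g + h) x) = (LINT x:A|lborel. rep_L1 g x) + (LINT x:A|lborel. rep_L1 h x)"
      using set_integral_add(2)[OF int int] by simp
    have "(LINT x:A|lborel. rep_L1 (c *\<^sub>R g) x) = (LINT x:A|lborel. c * rep_L1 g x)"
      unfolding set_lebesgue_integral_def using rep_L1_scaleR[of c g]
      by (intro integral_cong_AE) (auto elim!: eventually_mono)
    then show "(LINT x:A|lborel. rep_L1 (c *\<^sub>R g) x) = c *\<^sub>R (LINT x:A|lborel. rep_L1 g x)"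
      by simp
    have "norm (LINT x:A|lborel. rep_L1 g x) \<le> (LINT x|lborel. \<bar>indicator A x *\<^sub>R rep_L1 g x\<bar>)"
      unfolding set_lebesgue_integral_def using integral_norm_bound[of lborel "\<lambda>x. indicator A x *\<^sub>R rep_L1 g x"] by simp
    also have "\<dots> \<le> norm g"
      unfolding norm_L1_rep using int[of g] unfolding set_integrable_def
      by (intro Bochner_Integration.integral_mono) (auto simp: integrable_rep_L1 indicator_def)
    finally show "norm (LINT x:A|lborel. rep_L1 g x) \<le> norm g * 1" by simp
  qed
qed

lemma set_integral_rep_le:
  fixes g :: "'a::euclidean_space L1"
  assumes "Linf_le g M" and [measurable]: "A \<in> sets lborel" and fin: "emeasure lborel A < \<infinity>"
  shows "\<bar>LINT x:A|lborel. rep_L1 g x\<bar> \<le> M * measure lborel A"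
proof -
  have int: "integrable lborel (\<lambda>x. indicator A x *\<^sub>R rep_L1 g x)"
    by (rule integrable_mult_indicator[OF assms(2) integrable_rep_L1])
  have "\<bar>LINT x:A|lborel. rep_L1 g x\<bar> \<le> (LINT x|lborel. \<bar>indicator A x *\<^sub>R rep_L1 g x\<bar>)"
    unfolding set_lebesgue_integral_def using integral_norm_bound[of lborel "\<lambda>x. indicator A x *\<^sub>R rep_L1 g x"] by simp
  also have "\<dots> \<le> (LINT x|lborel. indicator A x * M)"
  proof (rule integral_mono_AE)
    have "integrable lborel (indicator A :: 'a \<Rightarrow> real)"
      by (rule integrable_real_indicator[OF \<open>A \<in> sets lborel\<close> fin])
    then show "integrable lborel (\<lambda>x. indicator A x * M)" by simp
    show "AE x in lborel. \<bar>indicator A x *\<^sub>R rep_L1 g x\<bar> \<le> indicator A x * M"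
      using assms(1) unfolding Linf_le_def by eventually_elim (auto simp: indicator_def)
  qed (use int in simp)
  finally show ?thesis using fin by (simp add: mult.commute)
qed

text \<open>Testing with the part of \<open>{g > M}\<close> in a ball gives a nonnegative function
  \<open>g - M\<close> of nonpositive integral, hence zero. The balls keep the test sets of finite
  measure and exhaust the space.\<close>

lemma AE_le_of_set_integral_le:
  fixes g :: "'a::euclidean_space \<Rightarrow> real"
  assumes g: "integrable lborel g"
    and le: "\<And>A. A \<in> sets lborel \<Longrightarrow> emeasure lborel A < \<infinity> \<Longrightarrow> (LINT x:A|lborel. g x) \<le> M * measure lborel A"
  shows "AE x in lborel. g x \<le> M"
proof -
  have [measurable]: "g \<in> borel_measurable lborel" using g by blast
  have "AE x in lborel. x \<in> ball 0 (real k) \<longrightarrow> g x \<le> M" for k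
  proof -
    define A where "A = {x \<in> ball 0 (real k). g x > M}"
    have [measurable]: "A \<in> sets lborel" unfolding A_def by measurable
    have fin: "emeasure lborel A < \<infinity>"
      by (rule emeasure_bounded_finite) (rule bounded_subset[OF bounded_ball[of 0 "real k"]], auto simp: A_def)
    have i1: "integrable lborel (\<lambda>x. indicator A x * g x)"
      using integrable_mult_indicator[OF \<open>A \<in> sets lborel\<close> g] by simp
    have "integrable lborel (indicator A :: 'a \<Rightarrow> real)"
      by (rule integrable_real_indicator[OF \<open>A \<in> sets lborel\<close> fin])
    then have i2: "integrable lborel (\<lambda>x. indicator A x * M)" by simp
    have int: "integrable lborel (\<lambda>x. indicator A x * (g x - M))"
      using Bochner_Integration.integrable_diff[OF i1 i2] by (simp add: algebra_simps)
    have nn: "AE x in lborel. 0 \<le> indicator A x * (g x - M)"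
      by (auto simp: A_def indicator_def)
    have "(LINT x|lborel. indicator A x * (g x - M)) = (LINT x:A|lborel. g x) - M * measure lborel A"
      using Bochner_Integration.integral_diff[OF i1 i2] fin
      by (simp add: set_lebesgue_integral_def algebra_simps)
    also have "\<dots> \<le> 0" using le[OF \<open>A \<in> sets lborel\<close> fin] by simp
    finally have "(LINT x|lborel. indicator A x * (g x - M)) = 0"
      using integral_nonneg_AE[OF nn] by linarith
    then have "AE x in lborel. indicator A x * (g x - M) = 0"
      using integral_nonneg_eq_0_iff_AE[OF int nn] by simp
    then show ?thesis by eventually_elim (auto simp: A_def indicator_def split: if_splits)
  qed
  then have "AE x in lborel. \<forall>k::nat. x \<in> ball 0 (real k) \<longrightarrow> g x \<le> M"
    unfolding AE_all_countable by blast
  then show ?thesis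
    by eventually_elim (metis mem_ball_0 reals_Archimedean2)
qed

text \<open>Essential boundedness becomes a family of closed conditions on continuous linear
  functionals. The nontrivial direction tests both \<open>g\<close> and \<open>- g\<close>.\<close>

lemma Linf_le_iff_set_integral:
  "Linf_le g M \<longleftrightarrow> (\<forall>A \<in> sets lborel. emeasure lborel A < \<infinity> \<longrightarrow>
     \<bar>LINT x:A|lborel. rep_L1 g x\<bar> \<le> M * measure lborel A)"
proof
  assume *: "\<forall>A \<in> sets lborel. emeasure lborel A < \<infinity> \<longrightarrow>
     \<bar>LINT x:A|lborel. rep_L1 g x\<bar> \<le> M * measure lborel A"
  have "AE x in lborel. rep_L1 g x \<le> M"
    using * by (intro AE_le_of_set_integral_le integrable_rep_L1) (auto dest!: abs_le_D1)
  moreover have "AE x in lborel. - rep_L1 g x \<le> M"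
  proof (intro AE_le_of_set_integral_le)
    show "integrable lborel (\<lambda>x. - rep_L1 g x)" by (simp add: integrable_rep_L1)
    fix A :: "'a set" assume "A \<in> sets lborel" "emeasure lborel A < \<infinity>"
    then have "\<bar>LINT x:A|lborel. rep_L1 g x\<bar> \<le> M * measure lborel A" using * by blast
    then show "(LINT x:A|lborel. - rep_L1 g x) \<le> M * measure lborel A"
      by (simp add: set_lebesgue_integral_def)
  qed
  ultimately show "Linf_le g M"
    unfolding Linf_le_def by eventually_elim auto
qed (use set_integral_rep_le in blast)

text \<open>The integral is formed in L^1, where essential bounds are not continuous data; each
  functional of the dual criterion passes under the integral and is bounded there.\<close>

lemma Linf_le_integral:
  fixes h :: "'b \<Rightarrow> 'a::euclidean_space L1"
  assumes h: "integrable N h" and m: "integrable N m" and le: "\<And>s. Linf_le (h s) (m s)"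
  shows "Linf_le (integral\<^sup>L N h) (integral\<^sup>L N m)"
  unfolding Linf_le_iff_set_integral
proof (intro ballI impI)
  fix A :: "'a set" assume A: "A \<in> sets lborel" "emeasure lborel A < \<infinity>"
  note bl = bounded_linear_set_integral_rep[OF A(1)]
  have "\<bar>LINT x:A|lborel. rep_L1 (integral\<^sup>L N h) x\<bar> = norm (LINT s|N. (LINT x:A|lborel. rep_L1 (h s) x))"
    by (simp add: integral_bounded_linear[OF bl h])
  also have "\<dots> \<le> (LINT s|N. norm (LINT x:A|lborel. rep_L1 (h s) x))"
    by (rule integral_norm_bound)
  also have "\<dots> \<le> (LINT s|N. m s * measure lborel A)"
    using set_integral_rep_le[OF le A] m integrable_bounded_linear[OF bl h]
    by (intro Bochner_Integration.integral_mono) auto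
  finally show "\<bar>LINT x:A|lborel. rep_L1 (integral\<^sup>L N h) x\<bar> \<le> integral\<^sup>L N m * measure lborel A"
    by simp
qed

section \<open>Convolution on \<open>L\<^sup>1\<close>\<close>

text \<open>A general kernel is allowed because differences of two heat kernels are convolved as
  well.\<close>

definition conv :: "('a::euclidean_space \<Rightarrow> real) \<Rightarrow> 'a L1 \<Rightarrow> 'a L1"
  where "conv k g = to_L1 (\<lambda>x. LINT y|lborel. k (x - y) * rep_L1 g y)"

lemma heat_eq_conv: "t > 0 \<Longrightarrow> heat t g = conv (heat_kernel t) g"
  by (simp add: heat_def conv_def)

lemma has_bochner_integral_translate:
  fixes k :: "'a::euclidean_space \<Rightarrow> real"
  assumes "integrable lborel k"
  shows "has_bochner_integral lborel (\<lambda>x. k (x - y)) (integral\<^sup>L lborel k)"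
proof -
  have [measurable]: "k \<in> borel_measurable borel" using assms by auto
  have "has_bochner_integral (distr lborel borel ((+) (- y))) k (integral\<^sup>L lborel k)"
    using assms by (simp add: lborel_distr_plus has_bochner_integral_iff)
  then have "has_bochner_integral lborel (\<lambda>x. k (- y + x)) (integral\<^sup>L lborel k)"
    by (simp add: has_bochner_integral_iff integrable_distr_eq integral_distr)
  then show ?thesis by simp
qed

lemma integrable_translate:
  fixes k :: "'a::euclidean_space \<Rightarrow> real"
  shows "integrable lborel k \<Longrightarrow> integrable lborel (\<lambda>x. k (x - y))"
  using has_bochner_integral_translate by (auto simp: has_bochner_integral_iff)

lemma integral_translate:
  fixes k :: "'a::euclidean_space \<Rightarrow> real"
  shows "integrable lborel k \<Longrightarrow> (LINT x|lborel. k (x - y)) = integral\<^sup>L lborel k"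
  by (rule has_bochner_integral_integral_eq[OF has_bochner_integral_translate])

text \<open>Integrating in \<open>x\<close> first, translation invariance leaves the L^1 norm of
  \<open>k\<close> times \<open>\<bar>g y\<bar>\<close>, which is integrable. Fubini's criterion is
  therefore applied with the variables exchanged.\<close>

lemma integrable_conv_pair:
  fixes k g :: "'a::euclidean_space \<Rightarrow> real"
  assumes k: "integrable lborel k" and g: "integrable lborel g"
  shows "integrable (lborel \<Otimes>\<^sub>M lborel) (\<lambda>(x, y). k (x - y) * g y)"
proof -
  have [measurable]: "k \<in> borel_measurable borel" "g \<in> borel_measurable borel"
    using k g by auto
  have "integrable (lborel \<Otimes>\<^sub>M lborel) (\<lambda>(y, x). k (x - y) * g y)"
  proof (rule lborel_pair.Fubini_integrable)
    have "(LINT x|lborel. norm (k (x - y) * g y)) = (LINT x|lborel. \<bar>k x\<bar>) * \<bar>g y\<bar>" for y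
      using integral_translate[of "\<lambda>x. \<bar>k x\<bar>" y] k by (simp add: abs_mult)
    then show "integrable lborel (\<lambda>y. LINT x|lborel. norm (case (y, x) of (y, x) \<Rightarrow> k (x - y) * g y))"
      using g by simp
    show "AE y in lborel. integrable lborel (\<lambda>x. case (y, x) of (y, x) \<Rightarrow> k (x - y) * g y)"
      using integrable_translate[OF k] by simp
  qed measurable
  from lborel_pair.integrable_product_swap[OF this] show ?thesis by simp
qed

lemma
  fixes k g :: "'a::euclidean_space \<Rightarrow> real"
  assumes k: "integrable lborel k" and g: "integrable lborel g"
  shows AE_integrable_conv: "AE x in lborel. integrable lborel (\<lambda>y. k (x - y) * g y)"
    and integrable_conv: "integrable lborel (\<lambda>x. LINT y|lborel. k (x - y) * g y)"
    and integral_conv: "(LINT x|lborel. LINT y|lborel. k (x - y) * g y) = integral\<^sup>L lborel k * integral\<^sup>L lborel g"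
proof -
  note p = integrable_conv_pair[OF k g]
  show "AE x in lborel. integrable lborel (\<lambda>y. k (x - y) * g y)"
    using lborel_pair.AE_integrable_fst'[OF p] by simp
  show "integrable lborel (\<lambda>x. LINT y|lborel. k (x - y) * g y)"
    using lborel_pair.integrable_fst'[OF p] by simp
  have "(LINT x|lborel. LINT y|lborel. k (x - y) * g y) = (LINT y|lborel. LINT x|lborel. k (x - y) * g y)"
    using lborel_pair.integral_fst'[OF p] lborel_pair.integral_snd[OF p] by simp
  also have "\<dots> = (LINT y|lborel. integral\<^sup>L lborel k * g y)"
    using integral_translate[OF k] by simp
  finally show "(LINT x|lborel. LINT y|lborel. k (x - y) * g y) = integral\<^sup>L lborel k * integral\<^sup>L lborel g"
    by simp
qed

lemma rep_conv:
  assumes "integrable lborel k"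
  shows "AE x in lborel. rep_L1 (conv k g) x = (LINT y|lborel. k (x - y) * rep_L1 g y)"
  unfolding conv_def to_L1_def
  using rep_abs_L1[OF integrable_conv[OF assms integrable_rep_L1]]
  by (simp add: integrable_conv[OF assms integrable_rep_L1])

lemma L1_eqI: "AE x in lborel. rep_L1 g x = rep_L1 h x \<Longrightarrow> g = h"
proof -
  assume "AE x in lborel. rep_L1 g x = rep_L1 h x"
  then have "AE x in lborel. \<bar>rep_L1 (g - h) x\<bar> \<le> 0 * \<bar>rep_L1 (g - h) x\<bar>"
    using rep_L1_diff[of g h] by eventually_elim auto
  then have "norm (g - h) \<le> 0" using norm_L1_le_mult by fastforce
  then show "g = h" by simp
qed

text \<open>Young's inequality in L^1, by Fubini for the absolute values.\<close>

lemma norm_conv_le: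
  assumes k: "integrable lborel k"
  shows "norm (conv k g) \<le> (LINT x|lborel. \<bar>k x\<bar>) * norm g"
proof -
  note ka = integrable_abs[OF k] and ga = integrable_abs[OF integrable_rep_L1[of g]]
  have "norm (conv k g) \<le> (LINT x|lborel. LINT y|lborel. \<bar>k (x - y)\<bar> * \<bar>rep_L1 g y\<bar>)"
    unfolding norm_L1_rep
  proof (rule integral_mono_AE)
    show "AE x in lborel. \<bar>rep_L1 (conv k g) x\<bar> \<le> (LINT y|lborel. \<bar>k (x - y)\<bar> * \<bar>rep_L1 g y\<bar>)"
      using rep_conv[OF k, of g]
    proof eventually_elim
      case (elim x)
      then show ?case
        using integral_norm_bound[of lborel "\<lambda>y. k (x - y) * rep_L1 g y"] by (simp add: abs_mult)
    qed
  qed (use integrable_conv[OF ka ga] integrable_rep_L1 in auto)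
  also have "\<dots> = (LINT x|lborel. \<bar>k x\<bar>) * norm g"
    unfolding norm_L1_rep by (rule integral_conv[OF ka ga])
  finally show ?thesis .
qed

lemma Linf_le_conv_kernel:
  assumes k: "integrable lborel k" and c: "\<And>x. \<bar>k x\<bar> \<le> c"
  shows "Linf_le (conv k g) (c * norm g)"
  unfolding Linf_le_def using rep_conv[OF k, of g] AE_integrable_conv[OF k integrable_rep_L1[of g]]
proof eventually_elim
  case (elim x)
  have "\<bar>LINT y|lborel. k (x - y) * rep_L1 g y\<bar> \<le> (LINT y|lborel. \<bar>k (x - y) * rep_L1 g y\<bar>)"
    using integral_norm_bound[of lborel "\<lambda>y. k (x - y) * rep_L1 g y"] by simp
  also have "\<dots> \<le> (LINT y|lborel. c * \<bar>rep_L1 g y\<bar>)"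
    using integrable_abs[OF elim(2)] integrable_abs[OF integrable_rep_L1[of g]] c
    by (intro Bochner_Integration.integral_mono) (auto simp: abs_mult intro: mult_right_mono)
  finally show ?case using elim(1) by (simp add: norm_L1_rep)
qed

text \<open>Evenness turns \<open>k (x - y)\<close> into a translate of \<open>k\<close> in the
  variable \<open>y\<close>, whose integral is known.\<close>

lemma Linf_le_conv:
  assumes k: "integrable lborel k" and even: "\<And>x. k (- x) = k x" and g: "Linf_le g M"
  shows "Linf_le (conv k g) ((LINT x|lborel. \<bar>k x\<bar>) * M)"
  unfolding Linf_le_def using rep_conv[OF k, of g] AE_integrable_conv[OF k integrable_rep_L1[of g]]
proof eventually_elim
  case (elim x)
  have ka: "has_bochner_integral lborel (\<lambda>y. \<bar>k (x - y)\<bar>) (LINT x|lborel. \<bar>k x\<bar>)"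
  proof -
    have "\<bar>k (x - y)\<bar> = \<bar>k (y - x)\<bar>" for y using even[of "x - y"] by simp
    then show ?thesis using has_bochner_integral_translate[OF integrable_abs[OF k], of x] by simp
  qed
  have "\<bar>LINT y|lborel. k (x - y) * rep_L1 g y\<bar> \<le> (LINT y|lborel. \<bar>k (x - y) * rep_L1 g y\<bar>)"
    using integral_norm_bound[of lborel "\<lambda>y. k (x - y) * rep_L1 g y"] by simp
  also have "\<dots> \<le> (LINT y|lborel. \<bar>k (x - y)\<bar> * M)"
  proof (rule integral_mono_AE)
    show "AE y in lborel. \<bar>k (x - y) * rep_L1 g y\<bar> \<le> \<bar>k (x - y)\<bar> * M"
      using g unfolding Linf_le_def by eventually_elim (auto simp: abs_mult intro: mult_left_mono)
  qed (use elim(2) ka in \<open>auto simp: has_bochner_integral_iff\<close>)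
  also have "\<dots> = (LINT x|lborel. \<bar>k x\<bar>) * M"
    using has_bochner_integral_integral_eq[OF ka] by simp
  finally show ?case using elim(1) by simp
qed

lemma conv_diff_kernel:
  assumes k: "integrable lborel k" and l: "integrable lborel l"
  shows "conv k g - conv l g = conv (\<lambda>x. k x - l x) g"
proof (rule L1_eqI)
  note kl = Bochner_Integration.integrable_diff[OF k l]
  show "AE x in lborel. rep_L1 (conv k g - conv l g) x = rep_L1 (conv (\<lambda>x. k x - l x) g) x"
    using rep_L1_diff[of "conv k g" "conv l g"] rep_conv[OF k, of g] rep_conv[OF l, of g] rep_conv[OF kl, of g]
      AE_integrable_conv[OF k integrable_rep_L1[of g]] AE_integrable_conv[OF l integrable_rep_L1[of g]]
    by eventually_elim (simp add: left_diff_distrib)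
qed

lemma bounded_linear_conv:
  assumes k: "integrable lborel k"
  shows "bounded_linear (conv k)"
proof (rule bounded_linear_intro[where K = "LINT x|lborel. \<bar>k x\<bar>"])
  fix g h :: "'a L1" and c :: real
  have *: "AE x in lborel. (LINT y|lborel. k (x - y) * rep_L1 (g + h) y) =
      (LINT y|lborel. k (x - y) * rep_L1 g y) + (LINT y|lborel. k (x - y) * rep_L1 h y)"
    using AE_integrable_conv[OF k integrable_rep_L1[of g]] AE_integrable_conv[OF k integrable_rep_L1[of h]]
      AE_integrable_conv[OF k integrable_rep_L1[of "g + h"]]
  proof eventually_elim
    case (elim x)
    have "(LINT y|lborel. k (x - y) * rep_L1 (g + h) y) = (LINT y|lborel. k (x - y) * rep_L1 g y + k (x - y) * rep_L1 h y)"
    proof (rule integral_cong_AE)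
      show "AE y in lborel. k (x - y) * rep_L1 (g + h) y = k (x - y) * rep_L1 g y + k (x - y) * rep_L1 h y"
        using rep_L1_add[of g h] by eventually_elim (simp add: algebra_simps)
    qed (use elim in auto)
    then show ?case using elim by simp
  qed
  show "conv k (g + h) = conv k g + conv k h"
    by (rule L1_eqI, use * rep_conv[OF k, of "g + h"] rep_conv[OF k, of g] rep_conv[OF k, of h]
        rep_L1_add[of "conv k g" "conv k h"] in eventually_elim) simp
  have *: "AE x in lborel. (LINT y|lborel. k (x - y) * rep_L1 (c *\<^sub>R g) y) =
      c * (LINT y|lborel. k (x - y) * rep_L1 g y)"
    using AE_integrable_conv[OF k integrable_rep_L1[of g]]
      AE_integrable_conv[OF k integrable_rep_L1[of "c *\<^sub>R g"]]
  proof eventually_elim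
    case (elim x)
    have "(LINT y|lborel. k (x - y) * rep_L1 (c *\<^sub>R g) y) = (LINT y|lborel. c * (k (x - y) * rep_L1 g y))"
    proof (rule integral_cong_AE)
      show "AE y in lborel. k (x - y) * rep_L1 (c *\<^sub>R g) y = c * (k (x - y) * rep_L1 g y)"
        using rep_L1_scaleR[of c g] by eventually_elim simp
    qed (use elim in auto)
    then show ?case by simp
  qed
  show "conv k (c *\<^sub>R g) = c *\<^sub>R conv k g"
    by (rule L1_eqI, use * rep_conv[OF k, of "c *\<^sub>R g"] rep_conv[OF k, of g]
        rep_L1_scaleR[of c "conv k g"] in eventually_elim) simp
  show "norm (conv k g) \<le> norm g * (LINT x|lborel. \<bar>k x\<bar>)"
    using norm_conv_le[OF k, of g] by (simp add: mult.commute)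
qed

section \<open>The heat kernel\<close>

text \<open>The kernel is a product of centred normal densities of variance \<open>2 * t\<close>, so
  its total mass follows from the one-dimensional Gaussian integral.\<close>

lemma heat_kernel_eq_prod:
  assumes "t > 0"
  shows "heat_kernel t (x :: 'a::euclidean_space) = (\<Prod>b\<in>Basis. normal_density 0 (sqrt (2 * t)) (x \<bullet> b))"
proof -
  have "(\<Prod>b\<in>Basis. normal_density 0 (sqrt (2 * t)) (x \<bullet> b)) =
      (\<Prod>b\<in>(Basis::'a set). 1 / sqrt (4 * pi * t)) * (\<Prod>b\<in>(Basis::'a set). exp (- (x \<bullet> b)\<^sup>2 / (4 * t)))"
    using assms by (subst prod.distrib[symmetric]) (simp add: normal_density_def algebra_simps)
  also have "(\<Prod>b\<in>(Basis::'a set). 1 / sqrt (4 * pi * t)) = (4 * pi * t) powr (- (DIM('a) / 2))"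
    using assms by (simp add: powr_minus powr_half_sqrt[symmetric] powr_powr power_inverse
        powr_realpow[symmetric] inverse_eq_divide power_one_over mult.commute)
  also have "(\<Prod>b\<in>(Basis::'a set). exp (- (x \<bullet> b)\<^sup>2 / (4 * t))) = exp (- (norm x)\<^sup>2 / (4 * t))"
    by (subst euclidean_inner[of x x, folded power2_norm_eq_inner power2_eq_square])
      (simp add: exp_sum[symmetric] sum_negf sum_divide_distrib)
  finally show ?thesis by (simp add: heat_kernel_def)
qed

lemma heat_kernel_pos: "t > 0 \<Longrightarrow> heat_kernel t x > 0"
  by (simp add: heat_kernel_def)

lemma heat_kernel_minus: "heat_kernel t (- x) = heat_kernel t x"
  by (simp add: heat_kernel_def)

lemma heat_kernel_le: "t > 0 \<Longrightarrow> heat_kernel t (x :: 'a::euclidean_space) \<le> (4 * pi * t) powr (- (DIM('a) / 2))"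
  unfolding heat_kernel_def by (rule mult_left_le) auto

lemma has_bochner_integral_heat_kernel:
  assumes t: "t > 0"
  shows "has_bochner_integral lborel (heat_kernel t :: 'a::euclidean_space \<Rightarrow> real) 1"
proof (rule has_bochner_integral_nn_integral)
  have "(\<integral>\<^sup>+x. heat_kernel t (x::'a) \<partial>lborel) = 
      (\<integral>\<^sup>+x. (\<Prod>b\<in>(Basis::'a set). ennreal (normal_density 0 (sqrt (2 * t)) (x \<bullet> b))) \<partial>lborel)"
    using t by (intro nn_integral_cong) (simp add: heat_kernel_eq_prod prod_ennreal)
  also have "\<dots> = (\<Prod>b\<in>(Basis :: 'a set). (\<integral>\<^sup>+x. ennreal (normal_density 0 (sqrt (2 * t)) x) \<partial>lborel))"
    by (rule nn_integral_lborel_prod) auto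
  also have "(\<integral>\<^sup>+x. ennreal (normal_density 0 (sqrt (2 * t)) x) \<partial>lborel) = 1"
    using t by (subst nn_integral_eq_integral) auto
  finally show "(\<integral>\<^sup>+x. heat_kernel t (x::'a) \<partial>lborel) = ennreal 1" by simp
  show "heat_kernel t \<in> borel_measurable lborel"
    unfolding heat_kernel_def by measurable
qed (use t in \<open>auto intro: less_imp_le heat_kernel_pos\<close>)

lemma integrable_heat_kernel: "t > 0 \<Longrightarrow> integrable lborel (heat_kernel t)"
  using has_bochner_integral_heat_kernel by (auto simp: has_bochner_integral_iff)

lemma integral_abs_heat_kernel: "t > 0 \<Longrightarrow> (LINT x|lborel. \<bar>heat_kernel t x\<bar>) = 1"
  using has_bochner_integral_integral_eq[OF has_bochner_integral_heat_kernel, of t]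
  by (simp add: heat_kernel_pos abs_of_pos)


text \<open>The factor \<open>d + 4\<close> is \<open>2 * (d / 2 + 2)\<close>, from the time
  derivative of the kernel; \<open>4 powr (d / 2)\<close> is the quotient of
  \<open>(2 * pi * t) powr (- (d / 2))\<close> by the normalisation of the kernel at time
  \<open>2 * t\<close>.\<close>

abbreviation (input) heat_const :: "nat \<Rightarrow> real"
  where "heat_const d \<equiv> (d + 4) * 4 powr (d / 2)"

text \<open>The mean value theorem in the time variable; the polynomial factor of the derivative is
  absorbed by half of the Gaussian exponent, which doubles the time.\<close>

lemma heat_kernel_diff_le:
  fixes x :: "'a::euclidean_space"
  assumes t: "t > 0" and s: "0 \<le> s" "s \<le> t / 2"
  shows "\<bar>heat_kernel (t - s) x - heat_kernel t x\<bar> \<le>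
    heat_const DIM('a) * (s / t) * heat_kernel (2 * t) x"
proof (cases "s = 0")
  case False
  define d where "d = real DIM('a)"
  define r where "r = (norm x)\<^sup>2"
  define D where "D \<tau> = (r / (4 * \<tau>\<^sup>2) - d / (2 * \<tau>)) * ((4 * pi * \<tau>) powr (- (d / 2)) * exp (- r / (4 * \<tau>)))" for \<tau>
  have der: "((\<lambda>\<tau>. heat_kernel \<tau> x) has_real_derivative D \<tau>) (at \<tau>)" if "\<tau> > 0" for \<tau>
  proof -
    have "(4 * pi * \<tau>) powr (- (d / 2) - 1) = (4 * pi * \<tau>) powr (- (d / 2)) / (4 * pi * \<tau>)"
      using that by (simp add: powr_diff)
    then show ?thesis
      unfolding heat_kernel_def D_def d_def[symmetric] r_def[symmetric] using that
      by (auto intro!: derivative_eq_intros simp: field_simps power2_eq_square)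
  qed
  obtain \<tau> where \<tau>: "t - s < \<tau>" "\<tau> < t"
    and eq: "heat_kernel t x - heat_kernel (t - s) x = (t - (t - s)) * D \<tau>"
    using MVT2[of "t - s" t "\<lambda>\<tau>. heat_kernel \<tau> x" D] der s t False by auto
  have \<tau>0: "\<tau> > 0" "t / 2 < \<tau>" using \<tau> s by auto
  define y where "y = r / (4 * \<tau>)"
  have y: "y \<ge> 0" using \<tau>0 by (simp add: y_def r_def)
  have "\<bar>D \<tau>\<bar> = \<bar>y - d / 2\<bar> * (1 / \<tau>) * ((4 * pi * \<tau>) powr (- (d / 2)) * exp (- y))"
  proof -
    have "r / (4 * \<tau>\<^sup>2) - d / (2 * \<tau>) = (y - d / 2) * (1 / \<tau>)"
      using \<tau>0 by (simp add: y_def field_simps power2_eq_square)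
    then show ?thesis using \<tau>0 by (simp add: D_def abs_mult y_def)
  qed
  also have "\<bar>y - d / 2\<bar> * (1 / \<tau>) * ((4 * pi * \<tau>) powr (- (d / 2)) * exp (- y)) =
      (1 / \<tau>) * (4 * pi * \<tau>) powr (- (d / 2)) * (\<bar>y - d / 2\<bar> * exp (- y))"
    by simp
  \<comment> \<open>The intermediate time satisfies \<open>t / 2 < \<tau> < t\<close>: the lower
    bound controls the two powers of \<tau>, the upper bound the Gaussian.\<close>
  also have "\<dots> \<le> (2 / t) * (2 * pi * t) powr (- (d / 2)) * ((d / 2 + 2) * exp (- r / (4 * (2 * t))))"
  proof (rule mult_mono[OF mult_mono])
    show "1 / \<tau> \<le> 2 / t" using \<tau>0 t by (simp add: field_simps)
    show "(4 * pi * \<tau>) powr (- (d / 2)) \<le> (2 * pi * t) powr (- (d / 2))"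
      using \<tau>0 t by (intro powr_mono2') (auto simp: d_def)
    have "\<bar>y - d / 2\<bar> \<le> d / 2 * 1 + y" using y by (simp add: d_def abs_if)
    also have "\<dots> \<le> d / 2 * exp (y / 2) + 2 * exp (y / 2)"
    proof (rule add_mono)
      show "y \<le> 2 * exp (y / 2)" using exp_ge_add_one_self[of "y / 2"] by linarith
    qed (use y in \<open>simp add: d_def\<close>)
    also have "\<dots> = (d / 2 + 2) * exp (y / 2)" by (simp add: algebra_simps)
    finally have "\<bar>y - d / 2\<bar> * exp (- y) \<le> (d / 2 + 2) * exp (y / 2) * exp (- y)"
      by (intro mult_right_mono) auto
    also have "\<dots> = (d / 2 + 2) * exp (- (y / 2))" by (simp add: exp_add[symmetric])
    also have "\<dots> \<le> (d / 2 + 2) * exp (- r / (4 * (2 * t)))"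
    proof -
      have "r / (8 * t) \<le> r / (8 * \<tau>)" using \<tau> \<tau>0 t by (intro divide_left_mono) (auto simp: r_def)
      then show ?thesis by (intro mult_left_mono) (auto simp: y_def d_def)
    qed
    finally show "\<bar>y - d / 2\<bar> * exp (- y) \<le> (d / 2 + 2) * exp (- r / (4 * (2 * t)))" .
  qed (use t \<tau>0 in auto)
  also have "(2 * pi * t) powr (- (d / 2)) = (4 * pi * (2 * t)) powr (- (d / 2)) * 4 powr (d / 2)"
  proof -
    have "(4 * pi * (2 * t)) powr (- (d / 2)) * 4 powr (d / 2) =
        (4 powr (- (d / 2)) * 4 powr (d / 2)) * (2 * pi * t) powr (- (d / 2))"
      using powr_mult[of 4 "2 * pi * t" "- (d / 2)"] t by (simp only: mult_ac)
    also have "4 powr (- (d / 2)) * 4 powr (d / 2) = (1::real)" by (subst powr_add[symmetric]) simp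
    finally show ?thesis by simp
  qed
  also have "2 / t * (P * Q) * ((d / 2 + 2) * E) = (d + 4) * Q * (1 / t) * (P * E)" for P Q E
    using t by (simp add: field_simps)
  finally have "\<bar>D \<tau>\<bar> \<le> (d + 4) * 4 powr (d / 2) * (1 / t) * heat_kernel (2 * t) x"
    unfolding heat_kernel_def r_def d_def .
  then have "s * \<bar>D \<tau>\<bar> \<le> s * ((d + 4) * 4 powr (d / 2) * (1 / t) * heat_kernel (2 * t) x)"
    using s by (intro mult_left_mono)
  then show ?thesis using eq s by (simp add: abs_minus_commute abs_mult d_def mult_ac)
qed simp

section \<open>The heat semigroup\<close>

text \<open>No sign condition on \<open>t\<close> is imposed, since \<open>heat t\<close> is the
  identity for \<open>t \<le> 0\<close>.\<close>

lemma bounded_linear_heat: "bounded_linear (heat t :: 'a::euclidean_space L1 \<Rightarrow> _)"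
proof (cases "t > 0")
  case True
  then have "heat t = conv (heat_kernel t :: 'a \<Rightarrow> real)" by (simp add: heat_eq_conv fun_eq_iff)
  then show ?thesis
    using bounded_linear_conv[OF integrable_heat_kernel[OF True]] by simp
next
  case False
  then have "heat t = (\<lambda>g :: 'a L1. g)" by (simp add: heat_def fun_eq_iff)
  then show ?thesis by (simp add: bounded_linear_ident)
qed

lemma norm_heat_le: "norm (heat t g) \<le> norm g"
proof (cases "t > 0")
  case True
  then show ?thesis
    using norm_conv_le[OF integrable_heat_kernel[OF True], of g]
    by (simp add: heat_eq_conv integral_abs_heat_kernel)
qed (simp add: heat_def)

lemma Linf_le_heat: "Linf_le g M \<Longrightarrow> Linf_le (heat t g) M"
proof (cases "t > 0")
  case True
  moreover assume "Linf_le g M"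
  ultimately show ?thesis
    using Linf_le_conv[OF integrable_heat_kernel[OF True] heat_kernel_minus, of g M]
    by (simp add: heat_eq_conv integral_abs_heat_kernel)
qed (simp add: heat_def)

lemma Linf_le_heat_smoothing:
  assumes t: "t > 0"
  shows "Linf_le (heat t (g :: 'a::euclidean_space L1)) ((4 * pi * t) powr (- (DIM('a) / 2)) * norm g)"
  unfolding heat_eq_conv[OF t]
  using heat_kernel_le[OF t, where 'a = 'a] heat_kernel_pos[OF t, where 'a = 'a]
  by (intro Linf_le_conv_kernel integrable_heat_kernel t) (simp add: abs_of_pos)

text \<open>The difference of the kernels is dominated by a multiple of the kernel at time
  \<open>2 * t\<close>, which has mass one and supremum
  \<open>(8 * pi * t) powr (- (DIM('a) / 2))\<close>.\<close>

lemma
  fixes g :: "'a::euclidean_space L1"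
  assumes t: "t > 0" and s: "0 \<le> s" "s \<le> t / 2"
  shows norm_heat_diff_le: "norm (heat (t - s) g - heat t g) \<le>
      heat_const DIM('a) * (s / t) * norm g"
    and Linf_le_heat_diff: "Linf_le (heat (t - s) g - heat t g)
      (heat_const DIM('a) * (s / t) * (8 * pi * t) powr (- (DIM('a) / 2)) * norm g)"
proof -
  let ?c = "heat_const DIM('a) * (s / t)"
  let ?k = "\<lambda>x :: 'a. heat_kernel (t - s) x - heat_kernel t x"
  have ts: "t - s > 0" and t2: "2 * t > 0" using t s by auto
  have k: "integrable lborel ?k"
    by (intro Bochner_Integration.integrable_diff integrable_heat_kernel t ts)
  have eq: "heat (t - s) g - heat t g = conv ?k g"
    unfolding heat_eq_conv[OF t] heat_eq_conv[OF ts]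
    by (intro conv_diff_kernel integrable_heat_kernel t ts)
  have "(LINT x|lborel. \<bar>?k x\<bar>) \<le> (LINT x|lborel. ?c * heat_kernel (2 * t) (x::'a))"
    using k integrable_heat_kernel[OF t2] heat_kernel_diff_le[OF t s]
    by (intro Bochner_Integration.integral_mono) auto
  also have "\<dots> = ?c"
    using has_bochner_integral_integral_eq[OF has_bochner_integral_heat_kernel[OF t2, where 'a = 'a]] by simp
  finally have "(LINT x|lborel. \<bar>?k x\<bar>) * norm g \<le> ?c * norm g" by (intro mult_right_mono) auto
  then show "norm (heat (t - s) g - heat t g) \<le> ?c * norm g"
    unfolding eq using norm_conv_le[OF k, of g] by linarith
  show "Linf_le (heat (t - s) g - heat t g) (?c * (8 * pi * t) powr (- (DIM('a) / 2)) * norm g)"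
    unfolding eq
  proof (rule Linf_le_conv_kernel[OF k])
    fix x :: 'a
    have "\<bar>?k x\<bar> \<le> ?c * heat_kernel (2 * t) x" by (rule heat_kernel_diff_le[OF t s])
    also have "\<dots> \<le> ?c * (4 * pi * (2 * t)) powr (- (DIM('a) / 2))"
      using t s by (intro mult_left_mono heat_kernel_le) auto
    finally show "\<bar>?k x\<bar> \<le> ?c * (8 * pi * t) powr (- (DIM('a) / 2))" by (simp add: mult.assoc)
  qed
qed

text \<open>Joint continuity serves the measurability of integrands such as
  \<open>heat (t - s) (h s)\<close>. Continuity in time for fixed \<open>g\<close> comes from the
  difference estimate, and contractivity makes it joint.\<close>

lemma continuous_on_heat:
  "continuous_on ({0<..} \<times> UNIV) (\<lambda>p. heat (fst p) (snd p :: 'a::euclidean_space L1))"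
proof (rule continuous_at_imp_continuous_on, safe)
  fix \<tau> :: real and g :: "'a L1" assume \<tau>: "\<tau> > 0"
  let ?c = "heat_const DIM('a)"
  \<comment> \<open>The estimate is applied with the later of the two times as base time; the
    restriction on \<open>r\<close> keeps the gap below half of it.\<close>
  have time: "norm (heat r g - heat \<tau> g) \<le> ?c * (\<bar>r - \<tau>\<bar> / \<tau>) * norm g" if r: "\<bar>r - \<tau>\<bar> < \<tau> / 2" for r
  proof (cases "r \<le> \<tau>")
    case True
    then show ?thesis
      using norm_heat_diff_le[of \<tau> "\<tau> - r" g] \<tau> r True by (cases "r = \<tau>") (auto simp: abs_if)
  next
    case False
    have "norm (heat r g - heat \<tau> g) \<le> ?c * (\<bar>r - \<tau>\<bar> / r) * norm g"
      using norm_heat_diff_le[of r "r - \<tau>" g] \<tau> r False by (simp add: abs_if norm_minus_commute)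
    also have "\<dots> \<le> ?c * (\<bar>r - \<tau>\<bar> / \<tau>) * norm g"
      using \<tau> False by (intro mult_right_mono mult_left_mono divide_left_mono) auto
    finally show ?thesis .
  qed
  let ?b = "\<lambda>p. norm (snd p - g) + ?c * (\<bar>fst p - \<tau>\<bar> / \<tau>) * norm g"
  have "((\<lambda>p. heat (fst p) (snd p) - heat \<tau> g) \<longlongrightarrow> 0) (at (\<tau>, g))"
  proof (rule Lim_null_comparison)
    have "((\<lambda>p. \<bar>fst p - \<tau>\<bar>) \<longlongrightarrow> \<bar>fst (\<tau>, g) - \<tau>\<bar>) (at (\<tau>, g))" by (intro tendsto_intros)
    then have "\<forall>\<^sub>F p in at (\<tau>, g). \<bar>fst p - \<tau>\<bar> < \<tau> / 2"
      using \<tau> by (intro order_tendstoD) auto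
    then show "\<forall>\<^sub>F p in at (\<tau>, g). norm (heat (fst p) (snd p) - heat \<tau> g) \<le> ?b p"
    proof eventually_elim
      case (elim p)
      interpret bounded_linear "heat (fst p) :: 'a L1 \<Rightarrow> _" by (rule bounded_linear_heat)
      have "norm (heat (fst p) (snd p) - heat \<tau> g) \<le>
          norm (heat (fst p) (snd p) - heat (fst p) g) + norm (heat (fst p) g - heat \<tau> g)"
        by (rule norm_diff_triangle_le) auto
      also have "norm (heat (fst p) (snd p) - heat (fst p) g) \<le> norm (snd p - g)"
        using norm_heat_le[of "fst p" "snd p - g"] by (simp add: diff)
      finally show ?case using time[OF elim] by linarith
    qed
    have "(?b \<longlongrightarrow> norm (snd (\<tau>, g) - g) + ?c * (\<bar>fst (\<tau>, g) - \<tau>\<bar> / \<tau>) * norm g) (at (\<tau>, g))"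
      using \<tau> by (intro tendsto_intros) auto
    then show "(?b \<longlongrightarrow> 0) (at (\<tau>, g))" by simp
  qed
  then show "isCont (\<lambda>p. heat (fst p) (snd p)) (\<tau>, g)"
    by (simp add: isCont_def LIM_zero_iff)
qed

lemma measurable_heat [measurable (raw)]:
  fixes g :: "'b \<Rightarrow> 'a::euclidean_space L1"
  assumes [measurable]: "\<tau> \<in> borel_measurable M" "g \<in> borel_measurable M"
  shows "(\<lambda>x. heat (\<tau> x) (g x)) \<in> borel_measurable M"
proof -
  have "(\<lambda>p. indicator ({0<..} \<times> UNIV) p *\<^sub>R heat (fst p) (snd p :: 'a L1)) \<in> borel_measurable borel"
    by (intro borel_measurable_continuous_on_indicator continuous_on_heat borel_open open_Times) auto
  then have "(\<lambda>p. if fst p > 0 then indicator ({0<..} \<times> UNIV) p *\<^sub>R heat (fst p) (snd p :: 'a L1) else snd p)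
      \<in> borel_measurable (borel \<Otimes>\<^sub>M borel)"
    \<comment> \<open>By second countability of L^1 the Borel sets of the product form the product
      sigma-algebra. For nonpositive times the identity is glued to the continuous part.\<close>
    unfolding borel_prod[symmetric] by measurable
  also have "(\<lambda>p. if fst p > 0 then indicator ({0<..} \<times> UNIV) p *\<^sub>R heat (fst p) (snd p :: 'a L1) else snd p) =
      (\<lambda>p. heat (fst p) (snd p))"
    by (auto simp: heat_def fun_eq_iff)
  finally have [measurable]: "(\<lambda>p. heat (fst p) (snd p :: 'a L1)) \<in> borel_measurable (borel \<Otimes>\<^sub>M borel)" .
  have "(\<lambda>x. (\<lambda>p. heat (fst p) (snd p)) (\<tau> x, g x)) \<in> borel_measurable M"
    by (rule measurable_compose[of _ _ "borel \<Otimes>\<^sub>M borel"]) measurable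
  then show ?thesis by simp
qed

section \<open>The Nemytskii operator\<close>

text \<open>By duality the set is an intersection of sublevel sets of continuous
  functionals.\<close>

lemma closed_Linf_le: "closed {g :: 'a::euclidean_space L1. Linf_le g M}"
proof -
  have "{g :: 'a L1. Linf_le g M} = (\<Inter>A \<in> {A \<in> sets lborel. emeasure lborel A < \<infinity>}.
      {g. \<bar>LINT x:A|lborel. rep_L1 g x\<bar> \<le> M * measure lborel A})"
    unfolding Linf_le_iff_set_integral by auto
  moreover have "closed {g :: 'a L1. \<bar>LINT x:A|lborel. rep_L1 g x\<bar> \<le> M * measure lborel A}"
    if "A \<in> sets lborel" for A
    using bounded_linear_set_integral_rep[OF that]
    by (intro closed_Collect_le continuous_intros linear_continuous_on)
  ultimately show ?thesis by auto
qed

text \<open>The linear bound makes the composition integrable, so the default value \<open>0\<close>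
  of \<open>to_L1\<close> is not taken.\<close>

lemma rep_nemytskii:
  assumes f: "f \<in> borel_measurable borel" and le: "AE x in lborel. \<bar>f (rep_L1 w x)\<bar> \<le> L * \<bar>rep_L1 w x\<bar>"
  shows "AE x in lborel. rep_L1 (nemytskii f w) x = f (rep_L1 w x)"
proof -
  have "integrable lborel (\<lambda>x. f (rep_L1 w x))"
  proof (rule Bochner_Integration.integrable_bound)
    show "integrable lborel (\<lambda>x. L * \<bar>rep_L1 w x\<bar>)" by (simp add: integrable_rep_L1)
    show "(\<lambda>x. f (rep_L1 w x)) \<in> borel_measurable lborel"
      by (rule measurable_compose[OF measurable_rep_L1 f])
    show "AE x in lborel. norm (f (rep_L1 w x)) \<le> norm (L * \<bar>rep_L1 w x\<bar>)"
      using le by eventually_elim auto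
  qed
  then show ?thesis unfolding nemytskii_def to_L1_def using rep_abs_L1 by auto
qed

lemma rep_nemytskii_diff_le:
  assumes f: "f \<in> borel_measurable borel" and f0: "f 0 = 0"
    and w: "Linf_le w M" and v: "Linf_le v M"
    and lip: "\<And>\<xi> \<eta>. \<bar>\<xi>\<bar> \<le> M \<Longrightarrow> \<bar>\<eta>\<bar> \<le> M \<Longrightarrow> \<bar>f \<xi> - f \<eta>\<bar> \<le> L * \<bar>\<xi> - \<eta>\<bar>"
  shows "AE x in lborel. \<bar>rep_L1 (nemytskii f w - nemytskii f v) x\<bar> \<le> L * \<bar>rep_L1 (w - v) x\<bar>"
proof -
  have *: "\<bar>f \<xi>\<bar> \<le> L * \<bar>\<xi>\<bar>" if "\<bar>\<xi>\<bar> \<le> M" for \<xi> using lip[of \<xi> 0] f0 that by simp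
  have "AE x in lborel. rep_L1 (nemytskii f w) x = f (rep_L1 w x)"
    using w unfolding Linf_le_def by (intro rep_nemytskii[OF f, where L = L]) (elim eventually_mono, rule *)
  moreover have "AE x in lborel. rep_L1 (nemytskii f v) x = f (rep_L1 v x)"
    using v unfolding Linf_le_def by (intro rep_nemytskii[OF f, where L = L]) (elim eventually_mono, rule *)
  ultimately show ?thesis
    using rep_L1_diff[of w v] rep_L1_diff[of "nemytskii f w" "nemytskii f v"] w v
    unfolding Linf_le_def by eventually_elim (simp add: lip)
qed

lemma nemytskii_zero:
  assumes "f \<in> borel_measurable borel" "f 0 = 0"
  shows "nemytskii f 0 = 0"
proof (rule L1_eqI)
  have "AE x in lborel. rep_L1 (nemytskii f (0 :: 'a L1)) x = f (rep_L1 (0 :: 'a L1) x)"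
    using rep_L1_zero[where 'a = 'a] assms(2)
    by (intro rep_nemytskii[OF assms(1), where L = 0]) (elim eventually_mono, simp)
  then show "AE x in lborel. rep_L1 (nemytskii f (0 :: 'a L1)) x = rep_L1 (0 :: 'a L1) x"
    using rep_L1_zero[where 'a = 'a] by eventually_elim (simp add: assms(2))
qed

text \<open>The operator is Lipschitz only on the set of functions bounded by \<open>M\<close>; this set is closed, hence
  a Borel set of \<open>L\<^sup>1\<close>.\<close>

lemma measurable_nemytskii:
  fixes w :: "'b \<Rightarrow> 'a::euclidean_space L1"
  assumes f: "f \<in> borel_measurable borel" and f0: "f 0 = 0"
    and lip: "\<And>\<xi> \<eta>. \<bar>\<xi>\<bar> \<le> M \<Longrightarrow> \<bar>\<eta>\<bar> \<le> M \<Longrightarrow> \<bar>f \<xi> - f \<eta>\<bar> \<le> L * \<bar>\<xi> - \<eta>\<bar>"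
    and w: "w \<in> borel_measurable N" and M: "\<And>x. Linf_le (w x) M"
  shows "(\<lambda>x. nemytskii f (w x)) \<in> borel_measurable N"
proof -
  let ?B = "{g :: 'a L1. Linf_le g M}"
  have "norm (nemytskii f g - nemytskii f h) \<le> L * norm (g - h)" if "g \<in> ?B" "h \<in> ?B" for g h
    using that by (intro norm_L1_le_mult rep_nemytskii_diff_le[OF f f0]) (auto intro: lip)
  then have "norm (nemytskii f g - nemytskii f h) \<le> \<bar>L\<bar> * norm (g - h)" if "g \<in> ?B" "h \<in> ?B" for g h
    using that by (meson abs_ge_self mult_right_mono norm_ge_zero order_trans)
  then have "\<bar>L\<bar>-lipschitz_on ?B (nemytskii f)"
    by (intro lipschitz_onI) (auto simp: dist_norm)
  then have "continuous_on ?B (nemytskii f)" by (rule lipschitz_on_continuous_on)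
  then have "(\<lambda>g. indicator ?B g *\<^sub>R nemytskii f g) \<in> borel_measurable borel"
    by (intro borel_measurable_continuous_on_indicator borel_closed closed_Linf_le)
  then have "(\<lambda>x. indicator ?B (w x) *\<^sub>R nemytskii f (w x)) \<in> borel_measurable N"
    by (rule measurable_compose[OF w])
  then show ?thesis using M by simp
qed

section \<open>Nonlinearities of power type\<close>

locale power_nonlinearity =
  fixes f :: "real \<Rightarrow> real" and K p :: real
  assumes f_0: "f 0 = 0" and K_pos: "K > 0" and p_gt_1: "p > 1"
    and f_lip: "\<bar>f \<xi> - f \<eta>\<bar> \<le> K * (\<bar>\<xi>\<bar> powr (p - 1) + \<bar>\<eta>\<bar> powr (p - 1)) * \<bar>\<xi> - \<eta>\<bar>"
begin

text \<open>The growth condition makes \<open>f\<close> continuous: its right-hand side tends to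
  zero as \<xi> tends to \<eta>.\<close>

lemma f_measurable: "f \<in> borel_measurable borel"
proof (rule borel_measurable_continuous_onI, rule continuous_at_imp_continuous_on, rule ballI)
  fix \<eta> :: real
  have powr: "((\<lambda>\<xi>. \<bar>\<xi>\<bar> powr (p - 1)) \<longlongrightarrow> \<bar>\<eta>\<bar> powr (p - 1)) (at \<eta>)"
    using p_gt_1 by (intro tendsto_powr'[OF tendsto_rabs[OF tendsto_ident_at] tendsto_const]) auto
  have "((\<lambda>\<xi>. K * (\<bar>\<xi>\<bar> powr (p - 1) + \<bar>\<eta>\<bar> powr (p - 1)) * \<bar>\<xi> - \<eta>\<bar>) \<longlongrightarrow>
      K * (\<bar>\<eta>\<bar> powr (p - 1) + \<bar>\<eta>\<bar> powr (p - 1)) * \<bar>\<eta> - \<eta>\<bar>) (at \<eta>)"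
    by (rule tendsto_mult[OF tendsto_mult[OF tendsto_const tendsto_add[OF powr tendsto_const]]
          tendsto_rabs[OF tendsto_diff[OF tendsto_ident_at tendsto_const]]])
  then have "((\<lambda>\<xi>. K * (\<bar>\<xi>\<bar> powr (p - 1) + \<bar>\<eta>\<bar> powr (p - 1)) * \<bar>\<xi> - \<eta>\<bar>) \<longlongrightarrow> 0) (at \<eta>)"
    by simp
  then have "((\<lambda>\<xi>. f \<xi> - f \<eta>) \<longlongrightarrow> 0) (at \<eta>)"
    by (rule Lim_null_comparison[rotated]) (simp add: f_lip)
  then show "isCont f \<eta>" by (simp add: isCont_def LIM_zero_iff)
qed

text \<open>The Lipschitz constant carries \<open>M powr (p - 1)\<close>; through this factor the
  decay of the supremum norm becomes decay of the nonlinear term.\<close>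

lemma f_lip_on:
  assumes "\<bar>\<xi>\<bar> \<le> M" "\<bar>\<eta>\<bar> \<le> M"
  shows "\<bar>f \<xi> - f \<eta>\<bar> \<le> 2 * K * M powr (p - 1) * \<bar>\<xi> - \<eta>\<bar>"
proof -
  have "\<bar>\<xi>\<bar> powr (p - 1) + \<bar>\<eta>\<bar> powr (p - 1) \<le> M powr (p - 1) + M powr (p - 1)"
    using assms p_gt_1 by (intro add_mono powr_mono2) auto
  then have "K * (\<bar>\<xi>\<bar> powr (p - 1) + \<bar>\<eta>\<bar> powr (p - 1)) * \<bar>\<xi> - \<eta>\<bar> \<le>
      K * (M powr (p - 1) + M powr (p - 1)) * \<bar>\<xi> - \<eta>\<bar>"
    using K_pos by (intro mult_right_mono mult_left_mono) auto
  with f_lip[of \<xi> \<eta>] show ?thesis by (simp add: algebra_simps)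
qed

lemma measurable_nemytskii_bounded:
  "w \<in> borel_measurable N \<Longrightarrow> (\<And>x. Linf_le (w x) M) \<Longrightarrow> (\<lambda>x. nemytskii f (w x)) \<in> borel_measurable N"
  by (rule measurable_nemytskii[OF f_measurable f_0 f_lip_on])

lemma
  assumes "Linf_le w M" "Linf_le v M"
  shows norm_nemytskii_diff_le: "norm (nemytskii f w - nemytskii f v) \<le> 2 * K * M powr (p - 1) * norm (w - v)"
    and Linf_le_nemytskii_diff: "Linf_le (w - v) D \<Longrightarrow>
      Linf_le (nemytskii f w - nemytskii f v) (2 * K * M powr (p - 1) * D)"
proof -
  have *: "AE x in lborel. \<bar>rep_L1 (nemytskii f w - nemytskii f v) x\<bar> \<le> 2 * K * M powr (p - 1) * \<bar>rep_L1 (w - v) x\<bar>"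
    by (rule rep_nemytskii_diff_le[OF f_measurable f_0 assms f_lip_on])
  show "norm (nemytskii f w - nemytskii f v) \<le> 2 * K * M powr (p - 1) * norm (w - v)"
    by (rule norm_L1_le_mult[OF *])
  show "Linf_le (w - v) D \<Longrightarrow> Linf_le (nemytskii f w - nemytskii f v) (2 * K * M powr (p - 1) * D)"
    using K_pos by (intro Linf_le_mult[OF *]) auto
qed

end

section \<open>Decay rates\<close>

text \<open>With \<open>a = N * \<sigma>\<close> this is the profile in the theorem. For
  \<open>a = 0\<close> and positive times it equals one, so that the start of the induction asks
  only for boundedness at the heat scaling.\<close>

definition rate :: "real \<Rightarrow> real \<Rightarrow> real"
  where "rate a t = (if a < 1 then t powr (- a) else if a = 1 then t powr (- 1) * ln (1 + t) else t powr (- 1))"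

lemma rate_pos: "t \<ge> 1 \<Longrightarrow> rate a t > 0"
  by (simp add: rate_def ln_gt_zero)

section \<open>The time integral and its three regimes\<close>

lemma has_bochner_integral_powr_Ici:
  fixes a b :: real
  assumes a: "a > 0" and b: "b \<ge> 0"
  shows "has_bochner_integral lborel (\<lambda>s. (1 + s) powr (- 1 - a) * indicator {b..} s) ((1 + b) powr (- a) / a)"
proof (rule has_bochner_integral_nn_integral)
  have lim: "((\<lambda>s. - ((1 + s) powr (- a) / a)) \<longlongrightarrow> - (0 / a)) at_top"
  proof (intro tendsto_intros)
    show "((\<lambda>s. (1 + s) powr (- a)) \<longlongrightarrow> 0) at_top"
      using a by (intro tendsto_neg_powr filterlim_tendsto_add_at_top[OF tendsto_const filterlim_ident]) auto
  qed (use a in auto)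
  have "(\<integral>\<^sup>+s. ennreal ((1 + s) powr (- 1 - a)) * indicator {b..} s \<partial>lborel) =
      ennreal (0 - - ((1 + b) powr (- a) / a))"
  proof (rule nn_integral_FTC_atLeast)
    fix s assume "b \<le> s"
    then have s: "1 + s > 0" using b by simp
    have "(1 + s) powr (- 1 - a) = (1 + s) powr (- a) / (1 + s)"
      using powr_diff[of "1 + s" "- a" 1] s by (simp add: minus_diff_commute)
    then show "((\<lambda>s. - ((1 + s) powr (- a) / a)) has_real_derivative (1 + s) powr (- 1 - a)) (at s)"
      using s a powr_diff[of "1 + s" "- a" 1] by (auto intro!: derivative_eq_intros)
  qed (use lim in auto)
  then show "(\<integral>\<^sup>+s. ennreal ((1 + s) powr (- 1 - a) * indicator {b..} s) \<partial>lborel) = ennreal ((1 + b) powr (- a) / a)"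
    by (simp add: ennreal_mult' ennreal_indicator)
qed (use a b in auto)

lemma set_integrable_powr_Ici: "a > 0 \<Longrightarrow> set_integrable lborel {0..} (\<lambda>s::real. (1 + s) powr (- 1 - a))"
  using has_bochner_integral_powr_Ici[of a 0]
  by (auto simp: set_integrable_def has_bochner_integral_iff mult.commute)

lemma set_integrable_min_powr:
  assumes "a > 0" "t > 0"
  shows "set_integrable lborel {0..} (\<lambda>s::real. min 1 (s / t) * (1 + s) powr (- 1 - a))"
  by (rule set_integrable_bound[OF set_integrable_powr_Ici[OF assms(1)]])
    (use assms in \<open>auto simp: abs_mult set_borel_measurable_def intro!: mult_left_le_one_le\<close>)

text \<open>Up to time \<open>t\<close> the weight \<open>s / t\<close> leaves
  \<open>(1 + s) powr (- a) / t\<close>, whose integral grows like a power, grows like a logarithm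
  or stays bounded; the tail beyond \<open>t\<close> contributes at most
  \<open>t powr (- a) / a\<close>.\<close>

lemma integral_min_powr_le:
  assumes a: "a > 0"
  obtains B where "B > 0"
    "\<And>t. t \<ge> 1 \<Longrightarrow> (LINT s:{0..}|lborel. min 1 (s / t) * (1 + s) powr (- 1 - a)) \<le> B * rate a t"
proof -
  let ?J = "\<lambda>t. (LINT s:{0..}|lborel. min 1 (s / t) * (1 + s) powr (- 1 - a))"
  have le: "(s / t) * (1 + s) powr (- 1 - a) \<le> (1 / t) * (1 + s) powr (- a)" if "s \<ge> 0" "t \<ge> 1" for s t :: real
  proof -
    have "(1 + s) powr (- a) = (1 + s) * (1 + s) powr (- 1 - a)"
      using that powr_mult_base[of "1 + s" "- 1 - a"] by simp
    then show ?thesis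
      using that by (simp add: divide_right_mono mult_right_mono)
  qed
  \<comment> \<open>The primitive \<open>F\<close> is kept abstract, so that the power and the
    logarithm share one computation.\<close>
  have split: "?J t \<le> (F t - F 0) / t + t powr (- a) / a"
    if t: "t \<ge> 1" and F: "\<And>s. s \<ge> 0 \<Longrightarrow> (F has_real_derivative (1 + s) powr (- a)) (at s)" for F t
  proof -
    note 1 = has_bochner_integral_powr_Ici[OF a, of t]
    have 2: "has_bochner_integral lborel (\<lambda>s. (1 + s) powr (- a) * indicator {0..t} s) (F t - F 0)"
      by (rule has_bochner_integral_FTC_Icc_nonneg) (use t F in auto)
    have "?J t \<le> (LINT s|lborel. (1 / t) * ((1 + s) powr (- a) * indicator {0..t} s) +
        (1 + s) powr (- 1 - a) * indicator {t..} s)"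
      unfolding set_lebesgue_integral_def
    proof (rule Bochner_Integration.integral_mono)
      show "integrable lborel (\<lambda>s. indicat_real {0..} s *\<^sub>R (min 1 (s / t) * (1 + s) powr (- 1 - a)))"
        using set_integrable_min_powr[OF a, of t] t by (simp add: set_integrable_def)
      show "integrable lborel (\<lambda>s. (1 / t) * ((1 + s) powr (- a) * indicator {0..t} s) +
        (1 + s) powr (- 1 - a) * indicator {t..} s)"
        using 1 2 t by (intro Bochner_Integration.integrable_add integrable_mult_right) (auto simp: has_bochner_integral_iff)
      fix s :: real
      show "indicat_real {0..} s *\<^sub>R (min 1 (s / t) * (1 + s) powr (- 1 - a)) \<le>
          (1 / t) * ((1 + s) powr (- a) * indicator {0..t} s) + (1 + s) powr (- 1 - a) * indicator {t..} s"
      proof (cases "0 \<le> s \<and> s \<le> t")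
        case True
        then have "min 1 (s / t) * (1 + s) powr (- 1 - a) \<le> (1 / t) * (1 + s) powr (- a)"
          using le[of s t] t by (intro order_trans[OF mult_right_mono[OF min.cobounded2]]) auto
        moreover have "0 \<le> (1 + s) powr (- 1 - a) * indicator {t..} s" by (simp add: indicator_def)
        moreover have "indicat_real {0..} s = 1" "indicat_real {0..t} s = 1" using True by auto
        ultimately show ?thesis by (simp only: real_scaleR_def mult_1_left mult_1_right)
      next
        case False
        then show ?thesis using t by (auto simp: indicator_def)
      qed
    qed
    also have "\<dots> = (1 / t) * (F t - F 0) + (1 + t) powr (- a) / a"
      using 1 2 t by (simp add: has_bochner_integral_iff)
    also have "\<dots> \<le> (F t - F 0) / t + t powr (- a) / a"
      using a t by (intro add_mono divide_right_mono powr_mono2') auto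
    finally show ?thesis .
  qed
  consider "a < 1" | "a = 1" | "a > 1" by linarith
  then show ?thesis
  proof cases
    case 1
    show ?thesis
    \<comment> \<open>The first summand comes from the integral up to \<open>t\<close>, using
      \<open>1 + t \<le> 2 * t\<close>; the second is the tail.\<close>
    proof (rule that[of "2 powr (1 - a) / (1 - a) + 1 / a"])
      show "2 powr (1 - a) / (1 - a) + 1 / a > 0" using 1 a by (intro add_pos_pos) auto
      fix t :: real assume t: "t \<ge> 1"
      have "?J t \<le> ((1 + t) powr (1 - a) / (1 - a) - (1 + 0) powr (1 - a) / (1 - a)) / t + t powr (- a) / a"
        by (rule split[OF t]) (use 1 in \<open>auto intro!: derivative_eq_intros\<close>)
      also have "\<dots> \<le> (2 * t) powr (1 - a) / (1 - a) / t + t powr (- a) / a"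
      proof (intro add_mono divide_right_mono)
        have "(1 + t) powr (1 - a) / (1 - a) \<le> (2 * t) powr (1 - a) / (1 - a)"
          using t 1 by (intro divide_right_mono powr_mono2) auto
        moreover have "(1 + 0) powr (1 - a) / (1 - a) \<ge> 0" using 1 by simp
        ultimately show "(1 + t) powr (1 - a) / (1 - a) - (1 + 0) powr (1 - a) / (1 - a) \<le> (2 * t) powr (1 - a) / (1 - a)"
          by linarith
      qed (use t a in auto)
      also have "(2 * t) powr (1 - a) = 2 powr (1 - a) * (t * t powr (- a))"
        using t powr_mult_base[of t "- a"] by (simp add: powr_mult)
      also have "2 powr (1 - a) * (t * t powr (- a)) / (1 - a) / t = 2 powr (1 - a) / (1 - a) * t powr (- a)"
        using t by simp
      finally show "?J t \<le> (2 powr (1 - a) / (1 - a) + 1 / a) * rate a t"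
        using 1 by (simp add: rate_def distrib_right)
    qed
  next
    case 2
    show ?thesis
    proof (rule that[of 3])
      fix t :: real assume t: "t \<ge> 1"
      have "?J t \<le> (ln (1 + t) - ln (1 + 0)) / t + t powr (- a) / a"
        by (rule split[OF t]) (use 2 in \<open>auto intro!: derivative_eq_intros simp: powr_minus field_simps\<close>)
      also have "\<dots> = ln (1 + t) / t + 1 / t" using t 2 by (simp add: powr_minus field_simps)
      \<comment> \<open>The tail is absorbed into the logarithm, since
        \<open>ln (1 + t) \<ge> ln 2 \<ge> 2 / 3\<close>; this makes the constant
        \<open>1 + 2 = 3\<close>.\<close>
      also have "1 / t \<le> (2 * ln (1 + t)) / t"
      proof (rule divide_right_mono)
        have "ln 2 \<le> ln (1 + t)" using t by simp
        then show "1 \<le> 2 * ln (1 + t)" using ln2_ge_two_thirds by linarith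
      qed (use t in auto)
      also have "ln (1 + t) / t + (2 * ln (1 + t)) / t = 3 * (ln (1 + t) / t)"
        by (simp add: add_divide_distrib[symmetric])
      finally show "?J t \<le> 3 * rate a t"
        using 2 t by (simp add: rate_def powr_minus field_simps)
    qed simp
  next
    case 3
    show ?thesis
    proof (rule that[of "1 / (a - 1)"])
      fix t :: real assume t: "t \<ge> 1"
      note 1 = has_bochner_integral_powr_Ici[of "a - 1" 0]
      \<comment> \<open>For \<open>a > 1\<close> the function \<open>(1 + s) powr (- a)\<close> is
        integrable on the half-line, so the weight \<open>s / t\<close> serves for all
        \<open>s\<close> without splitting.\<close>
      have "?J t \<le> (LINT s|lborel. (1 / t) * ((1 + s) powr (- 1 - (a - 1)) * indicator {0..} s))"
        unfolding set_lebesgue_integral_def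
      proof (rule Bochner_Integration.integral_mono)
        show "integrable lborel (\<lambda>s. indicat_real {0..} s *\<^sub>R (min 1 (s / t) * (1 + s) powr (- 1 - a)))"
          using set_integrable_min_powr[OF a, of t] t by (simp add: set_integrable_def)
        show "integrable lborel (\<lambda>s. (1 / t) * ((1 + s) powr (- 1 - (a - 1)) * indicator {0..} s))"
          using 1 3 by (intro integrable_mult_right) (auto simp: has_bochner_integral_iff)
        fix s :: real
        have "min 1 (s / t) * (1 + s) powr (- 1 - a) \<le> (s / t) * (1 + s) powr (- 1 - a)"
          by (intro mult_right_mono) auto
        then show "indicat_real {0..} s *\<^sub>R (min 1 (s / t) * (1 + s) powr (- 1 - a)) \<le>
          (1 / t) * ((1 + s) powr (- 1 - (a - 1)) * indicator {0..} s)"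
          using le[of s t] t by (auto simp: indicator_def)
      qed
      also have "\<dots> = (1 / t) * (1 / (a - 1))"
        using 1 3 by (simp add: has_bochner_integral_iff)
      finally show "?J t \<le> 1 / (a - 1) * rate a t"
        using 3 t by (simp add: rate_def powr_minus field_simps)
    qed (use 3 in simp)
  qed
qed

lemma powr_minus_le_powr_minus_Suc:
  fixes t a :: real
  assumes "t \<ge> 1" "a \<ge> 0"
  shows "t powr (- a) \<le> 2 powr a * (1 + t) powr (- a)"
proof -
  have "(2 * t) powr (- a) \<le> (1 + t) powr (- a)" using assms by (intro powr_mono2') auto
  then have "2 powr a * (2 * t) powr (- a) \<le> 2 powr a * (1 + t) powr (- a)" by (intro mult_left_mono) auto
  also have "2 powr a * (2 * t) powr (- a) = t powr (- a)"
    using assms by (simp add: powr_mult powr_minus)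
  finally show ?thesis .
qed

text \<open>At the critical exponent the logarithm costs an arbitrarily small power, which is less than
  what the next iteration gains.\<close>

lemma rate_le_powr:
  assumes \<sigma>: "\<sigma> > 0" and c: "c \<ge> 0"
  obtains b B where "b \<ge> 0" "B > 0" "rate (\<sigma> + b) = rate (\<sigma> + c)"
    "\<And>t. t \<ge> 1 \<Longrightarrow> rate c t \<le> B * (1 + t) powr (- b)"
proof -
  consider "c < 1" | "c = 1" | "c > 1" by linarith
  then show ?thesis
  proof cases
    case 1
    then show ?thesis
      using powr_minus_le_powr_minus_Suc c by (intro that[of c "2 powr c"]) (auto simp: rate_def)
  next
    case 2
    \<comment> \<open>The loss \<open>e\<close> stays below \<sigma>, so
      \<open>\<sigma> + (1 - e)\<close> still exceeds one and has the same rate as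
      \<open>\<sigma> + 1\<close>; being at most one half, it leaves \<open>1 - e\<close>
      positive.\<close>
    define e where "e = min \<sigma> 1 / 2"
    have e: "0 < e" "e < 1" "e < \<sigma>" using \<sigma> by (auto simp: e_def)
    show ?thesis
    proof (rule that[of "1 - e" "2 / e"])
      show "rate (\<sigma> + (1 - e)) = rate (\<sigma> + c)" using 2 e \<sigma> by (auto simp: rate_def fun_eq_iff)
      fix t :: real assume t: "t \<ge> 1"
      have "t powr (- 1) * ln (1 + t) \<le> 2 * (1 + t) powr (- 1) * ((1 + t) powr e / e)"
        using powr_minus_le_powr_minus_Suc[OF t, of 1] ln_powr_bound[of "1 + t" e] t e
        by (intro mult_mono) auto
      also have "\<dots> = 2 / e * ((1 + t) powr (- 1) * (1 + t) powr e)" by simp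
      also have "(1 + t) powr (- 1) * (1 + t) powr e = (1 + t) powr (- (1 - e))"
        by (subst powr_add[symmetric]) simp
      finally show "rate c t \<le> 2 / e * (1 + t) powr (- (1 - e))" using 2 by (simp add: rate_def)
    qed (use e in auto)
  next
    case 3
    show ?thesis
    proof (rule that[of 1 2])
      show "rate (\<sigma> + 1) = rate (\<sigma> + c)" using 3 \<sigma> by (auto simp: rate_def fun_eq_iff)
      show "rate c t \<le> 2 * (1 + t) powr (- 1)" if "t \<ge> 1" for t
        using powr_minus_le_powr_minus_Suc[OF that, of 1] 3 by (simp add: rate_def)
    qed auto
  qed
qed

text \<open>The rate may be singular at time zero, so it is required only from time one on;
  boundedness covers earlier times. The extra factor in the supremum bound is the scaling of the
  heat semigroup from L^1.\<close>

definition decays :: "real \<Rightarrow> (real \<Rightarrow> 'a::euclidean_space L1) \<Rightarrow> bool"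
  where "decays c D \<longleftrightarrow> (\<exists>B. (\<forall>t\<ge>0. norm (D t) \<le> B \<and> Linf_le (D t) B) \<and>
    (\<forall>t\<ge>1. norm (D t) \<le> B * rate c t \<and> Linf_le (D t) (B * rate c t * t powr (- (DIM('a) / 2)))))"

lemma decays_cong: "rate c = rate c' \<Longrightarrow> (\<And>t. t \<ge> 0 \<Longrightarrow> D t = D' t) \<Longrightarrow> decays c D = decays c' D'"
  by (simp add: decays_def)

text \<open>Rewrites the decay in powers of \<open>1 + t\<close>, valid down to time zero, as needed
  to integrate a source from zero. The exponent may drop from \<open>c\<close> to \<open>b\<close>,
  but the rate after the next gain of \<sigma> is the same.\<close>

lemma decays_imp_powr:
  fixes D :: "real \<Rightarrow> 'a::euclidean_space L1"
  assumes D: "decays c D" and \<sigma>: "\<sigma> > 0" and c: "c \<ge> 0"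
  obtains b B where "b \<ge> 0" "B > 0" "rate (\<sigma> + b) = rate (\<sigma> + c)"
    "\<And>t. t \<ge> 0 \<Longrightarrow> norm (D t) \<le> B * (1 + t) powr (- b)"
    "\<And>t. t \<ge> 0 \<Longrightarrow> Linf_le (D t) (B * (1 + t) powr (- b - DIM('a) / 2))"
proof -
  let ?d = "DIM('a) / 2"
  obtain A where A: "\<And>t. t \<ge> 0 \<Longrightarrow> norm (D t) \<le> A \<and> Linf_le (D t) A"
    "\<And>t. t \<ge> 1 \<Longrightarrow> norm (D t) \<le> A * rate c t \<and> Linf_le (D t) (A * rate c t * t powr (- ?d))"
    using D unfolding decays_def by blast
  obtain b R where b: "b \<ge> 0" "R > 0" "rate (\<sigma> + b) = rate (\<sigma> + c)"
    "\<And>t. t \<ge> 1 \<Longrightarrow> rate c t \<le> R * (1 + t) powr (- b)"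
    using rate_le_powr[OF \<sigma> c] by blast
  have A0: "A \<ge> 0" using A(1)[of 0] Linf_le_nonneg by auto
  \<comment> \<open>A common majorant of the three constants \<open>A * R * 2 powr ?d\<close>,
    \<open>A * R\<close> and \<open>A * 2 powr (b + ?d)\<close>; the added ones ensure positivity
    and allow the comparisons.\<close>
  define B where "B = (A + 1) * (R + 1) * 2 powr (b + ?d)"
  have p1: "2 powr (b + ?d) \<ge> 1" using b by (simp add: ge_one_powr_ge_zero)
  have AB: "A * R * 2 powr ?d \<le> B"
    unfolding B_def using A0 b by (intro mult_mono powr_mono) auto
  have "A * R \<le> (A + 1) * (R + 1)" using A0 b by (intro mult_mono) auto
  from mult_mono[OF this p1] have AB': "A * R \<le> B" using A0 b by (simp add: B_def)
  have AB'': "A * 2 powr (b + ?d) \<le> B"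
    using mult_mono[of A "A + 1" 1 "R + 1"] A0 b unfolding B_def by (intro mult_right_mono) auto
  show ?thesis
  proof (rule that[OF b(1) _ b(3)])
    show "B > 0" unfolding B_def using A0 b by (intro mult_pos_pos) auto
    fix t :: real assume t: "t \<ge> 0"
    have "norm (D t) \<le> B * (1 + t) powr (- b) \<and> Linf_le (D t) (B * (1 + t) powr (- b - ?d))"
    proof (cases "t \<ge> 1")
      case True
      have AR: "A * rate c t \<le> A * R * (1 + t) powr (- b)"
        using b(4)[OF True] A0 by (simp add: mult_left_mono mult.assoc)
      also have "\<dots> \<le> B * (1 + t) powr (- b)" using AB' by (intro mult_right_mono) auto
      finally have 1: "A * rate c t \<le> B * (1 + t) powr (- b)" .
      have "A * rate c t * t powr (- ?d) \<le> (A * R * (1 + t) powr (- b)) * (2 powr ?d * (1 + t) powr (- ?d))"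
        using powr_minus_le_powr_minus_Suc[OF True, of ?d] A0 b(2)
        by (intro mult_mono[OF AR]) auto
      also have "\<dots> = (A * R * 2 powr ?d) * (1 + t) powr (- b - ?d)"
        using powr_add[of "1 + t" "- b" "- ?d"] by simp
      also have "\<dots> \<le> B * (1 + t) powr (- b - ?d)" using AB by (intro mult_right_mono) auto
      finally show ?thesis using A(2)[OF True] 1 by (meson Linf_le_mono order_trans)
    next
      case False
      \<comment> \<open>Before time one \<open>1 + t \<le> 2\<close>, so trading the uniform bound
        for \<open>(1 + t) powr (- e)\<close> costs at most \<open>2 powr e\<close>.\<close>
      have *: "A \<le> B * (1 + t) powr (- e)" if "0 \<le> e" "e \<le> b + ?d" for e
      proof -
        have "A = (A * 2 powr e) * 2 powr (- e)" by (simp add: powr_minus)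
        also have "\<dots> \<le> (A * 2 powr (b + ?d)) * (1 + t) powr (- e)"
          using that A0 False t by (intro mult_mono mult_left_mono powr_mono powr_mono2') auto
        also have "\<dots> \<le> B * (1 + t) powr (- e)" using AB'' by (intro mult_right_mono) auto
        finally show ?thesis .
      qed
      have "A \<le> B * (1 + t) powr (- b)" using b by (intro *) auto
      moreover have "A \<le> B * (1 + t) powr (- b - ?d)" using *[of "b + ?d"] b by (simp add: algebra_simps)
      ultimately show ?thesis using A(1)[OF t] by (meson Linf_le_mono order_trans)
    qed
    then show "norm (D t) \<le> B * (1 + t) powr (- b)" "Linf_le (D t) (B * (1 + t) powr (- b - ?d))" by auto
  qed
qed

section \<open>The linear estimate\<close>

lemma
  fixes h :: "'b \<Rightarrow> 'a::euclidean_space L1"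
  assumes h: "set_integrable N A h" and m: "set_integrable N A m"
  shows norm_set_integral_le: "(\<And>s. s \<in> A \<Longrightarrow> norm (h s) \<le> m s) \<Longrightarrow>
      norm (LINT s:A|N. h s) \<le> (LINT s:A|N. m s)"
    and Linf_le_set_integral: "(\<And>s. s \<in> A \<Longrightarrow> Linf_le (h s) (m s)) \<Longrightarrow>
      Linf_le (LINT s:A|N. h s) (LINT s:A|N. m s)"
proof -
  show "norm (LINT s:A|N. h s) \<le> (LINT s:A|N. m s)" if "\<And>s. s \<in> A \<Longrightarrow> norm (h s) \<le> m s"
    unfolding set_lebesgue_integral_def
  proof (rule order_trans[OF integral_norm_bound Bochner_Integration.integral_mono])
    show "integrable N (\<lambda>s. norm (indicator A s *\<^sub>R h s))"
      using h unfolding set_integrable_def by (rule integrable_norm)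
    show "norm (indicator A s *\<^sub>R h s) \<le> indicator A s *\<^sub>R m s" for s
      using that by (auto simp: indicator_def)
  qed (use h m in \<open>auto simp: set_integrable_def\<close>)
  show "Linf_le (LINT s:A|N. h s) (LINT s:A|N. m s)" if "\<And>s. s \<in> A \<Longrightarrow> Linf_le (h s) (m s)"
    unfolding set_lebesgue_integral_def
  proof (rule Linf_le_integral)
    show "Linf_le (indicator A s *\<^sub>R h s) (indicator A s *\<^sub>R m s)" for s
      using that by (auto simp: indicator_def Linf_le_zero)
  qed (use h m in \<open>auto simp: set_integrable_def\<close>)
qed

lemma set_integral_heat:
  fixes h :: "'b \<Rightarrow> 'a::euclidean_space L1"
  assumes "set_integrable N A h"
  shows "heat t (LINT s:A|N. h s) = (LINT s:A|N. heat t (h s))"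
proof -
  interpret bounded_linear "heat t :: 'a L1 \<Rightarrow> _" by (rule bounded_linear_heat)
  show ?thesis
    using integral_bounded_linear[OF bounded_linear_heat assms[unfolded set_integrable_def], of t]
    by (simp add: set_lebesgue_integral_def scaleR)
qed

text \<open>Puts the Duhamel integral up to \<open>t\<close> and the mass integral over the
  half-line under one integral sign. For \<open>s > t\<close> only the subtracted term
  remains.\<close>

definition heat_defect :: "(real \<Rightarrow> 'a::euclidean_space L1) \<Rightarrow> real \<Rightarrow> real \<Rightarrow> 'a L1"
  where "heat_defect h t s = (if s \<le> t then heat (t - s) (h s) else 0) - heat t (h s)"

lemma
  fixes g :: "'a::euclidean_space L1"
  shows norm_heat_diff_le_trivial: "norm (heat r g - heat t g) \<le> 2 * norm g"
    and Linf_le_heat_diff_trivial: "Linf_le g M \<Longrightarrow> Linf_le (heat r g - heat t g) (2 * M)"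
proof -
  show "norm (heat r g - heat t g) \<le> 2 * norm g"
    using norm_triangle_ineq4[of "heat r g" "heat t g"] norm_heat_le[of r g] norm_heat_le[of t g] by linarith
  show "Linf_le g M \<Longrightarrow> Linf_le (heat r g - heat t g) (2 * M)"
    using Linf_le_diff[OF Linf_le_heat Linf_le_heat] by (metis mult_2)
qed

text \<open>Positivity of \<open>a\<close> makes the source integrable in time. The stronger decay
  of its supremum norm is needed for \<open>s\<close> near \<open>t\<close>, where
  \<open>heat (t - s)\<close> provides no smoothing.\<close>

locale decaying_source =
  fixes h :: "real \<Rightarrow> 'a::euclidean_space L1" and a C :: real
  assumes a_pos: "a > 0" and C_nonneg: "C \<ge> 0"
    and h_measurable [measurable]: "h \<in> borel_measurable borel"
    and norm_h: "s \<ge> 0 \<Longrightarrow> norm (h s) \<le> C * (1 + s) powr (- 1 - a)"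
    and Linf_h: "s \<ge> 0 \<Longrightarrow> Linf_le (h s) (C * (1 + s) powr (- 1 - a - DIM('a) / 2))"
begin

lemma set_integrable_majorant: "set_integrable lborel {0..} (\<lambda>s::real. C * (1 + s) powr (- 1 - a))"
  using set_integrable_powr_Ici[OF a_pos] by simp

lemma set_integrable_heat:
  "set_integrable lborel {0..} (\<lambda>s. if s \<le> t then heat (t - s) (h s) else 0)"
proof (rule set_integrable_bound[OF set_integrable_majorant])
  show "AE s in lborel. s \<in> {0..} \<longrightarrow>
      norm (if s \<le> t then heat (t - s) (h s) else 0) \<le> norm (C * (1 + s) powr (- 1 - a))"
    using norm_h C_nonneg order_trans[OF norm_heat_le norm_h] by auto
  show "set_borel_measurable lborel {0..} (\<lambda>s. if s \<le> t then heat (t - s) (h s) else 0)"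
    unfolding set_borel_measurable_def by measurable
qed

lemma integral_heat_eq:
  "(LINT s:{0..t}|lborel. heat (t - s) (h s)) = (LINT s:{0..}|lborel. if s \<le> t then heat (t - s) (h s) else 0)"
  unfolding set_lebesgue_integral_def
  by (rule Bochner_Integration.integral_cong) (auto simp: indicator_def)

lemma set_integrable_heat_Icc: "set_integrable lborel {0..t} (\<lambda>s. heat (t - s) (h s))"
proof -
  have "(\<lambda>s. indicat_real {0..} s *\<^sub>R (if s \<le> t then heat (t - s) (h s) else 0)) =
      (\<lambda>s. indicat_real {0..t} s *\<^sub>R heat (t - s) (h s))"
    by (auto simp: indicator_def fun_eq_iff)
  then show ?thesis using set_integrable_heat[of t] by (simp add: set_integrable_def)
qed

lemma set_integrable_h: "set_integrable lborel {0..} h"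
proof (rule set_integrable_bound[OF set_integrable_majorant])
  show "AE s in lborel. s \<in> {0..} \<longrightarrow> norm (h s) \<le> norm (C * (1 + s) powr (- 1 - a))"
    using norm_h C_nonneg by auto
  show "set_borel_measurable lborel {0..} h"
    unfolding set_borel_measurable_def by measurable
qed

lemma set_integrable_heat_h: "set_integrable lborel {0..} (\<lambda>s. heat t (h s))"
proof (rule set_integrable_bound[OF set_integrable_h])
  show "set_borel_measurable lborel {0..} (\<lambda>s. heat t (h s))"
    unfolding set_borel_measurable_def by measurable
qed (simp add: norm_heat_le)

lemma set_integrable_heat_defect: "set_integrable lborel {0..} (heat_defect h t)"
  unfolding heat_defect_def[abs_def] by (rule set_integral_diff(1)[OF set_integrable_heat set_integrable_heat_h])

lemma heat_defect_integral:
  "(LINT s:{0..t}|lborel. heat (t - s) (h s)) - heat t (LINT s:{0..}|lborel. h s) =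
    (LINT s:{0..}|lborel. heat_defect h t s)"
  unfolding integral_heat_eq set_integral_heat[OF set_integrable_h] heat_defect_def
  by (rule set_integral_diff(2)[OF set_integrable_heat set_integrable_heat_h, symmetric])

text \<open>Lets the constant of the kernel difference also cover the ranges
  \<open>t / 2 < s \<le> t\<close> and \<open>s > t\<close>.\<close>

lemma heat_const_ge: "4 * 2 powr (DIM('a) / 2) \<le> heat_const DIM('a)" "4 \<le> heat_const DIM('a)"
proof -
  show *: "4 * 2 powr (DIM('a) / 2) \<le> heat_const DIM('a)" by (intro mult_mono powr_mono2) auto
  have "1 \<le> (2::real) powr (DIM('a) / 2)" by (simp add: ge_one_powr_ge_zero)
  then show "4 \<le> heat_const DIM('a)" using * by linarith
qed

text \<open>Uses only that the semigroup contracts both norms, so there is no singularity at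
  \<open>t = 0\<close> and no cancellation between the two terms.\<close>

lemma heat_defect_le_trivial:
  assumes s: "s \<ge> 0"
  shows "norm (heat_defect h t s) \<le> 2 * C * (1 + s) powr (- 1 - a)"
    and "Linf_le (heat_defect h t s) (2 * C * (1 + s) powr (- 1 - a - DIM('a) / 2))"
proof -
  have le: "norm (heat_defect h t s) \<le> 2 * norm (h s)"
  proof (cases "s \<le> t")
    case False
    then show ?thesis
      using norm_heat_le[of t "h s"] norm_ge_zero[of "h s"] by (simp add: heat_defect_def del: norm_ge_zero)
  qed (simp add: heat_defect_def norm_heat_diff_le_trivial)
  show "norm (heat_defect h t s) \<le> 2 * C * (1 + s) powr (- 1 - a)"
    using norm_h[OF s] le by linarith
  have *: "Linf_le (heat_defect h t s) (2 * (C * (1 + s) powr (- 1 - a - DIM('a) / 2)))"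
  proof (cases "s \<le> t")
    case False
    then show ?thesis
      using Linf_le_diff[OF Linf_le_zero Linf_le_heat[OF Linf_h[OF s]], of t] C_nonneg
      by (auto simp: heat_defect_def elim: Linf_le_mono)
  qed (simp add: heat_defect_def Linf_le_heat_diff_trivial Linf_h[OF s])
  then show "Linf_le (heat_defect h t s) (2 * C * (1 + s) powr (- 1 - a - DIM('a) / 2))"
    by (simp add: mult.assoc)
qed

text \<open>Three ranges. For \<open>s \<le> t / 2\<close> the kernel difference gains
  \<open>s / t\<close>; for \<open>t / 2 < s \<le> t\<close> the source itself decays like
  \<open>t powr (- (DIM('a) / 2))\<close> in supremum norm; for \<open>s > t\<close> only
  \<open>heat t (h s)\<close> is left, and smoothing gives this factor.\<close>

lemma heat_defect_le:
  assumes t: "t > 0" and s: "s \<ge> 0"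
  shows "norm (heat_defect h t s) \<le> heat_const DIM('a) * C * (min 1 (s / t) * (1 + s) powr (- 1 - a))"
    and "Linf_le (heat_defect h t s) (heat_const DIM('a) * C * t powr (- (DIM('a) / 2)) * (min 1 (s / t) * (1 + s) powr (- 1 - a)))"
proof -
  let ?d = "DIM('a) / 2"
  let ?p = "(1 + s) powr (- 1 - a)"
  \<comment> \<open>Drops the numerical normalisation of the kernels at times \<open>t\<close> and
    \<open>2 * t\<close>.\<close>
  have small: "(e * pi * t) powr (- ?d) \<le> t powr (- ?d)" if "e \<ge> 1" for e
  proof -
    have "1 \<le> e * pi" using mult_mono[of 1 e 1 pi] that pi_ge_two by simp
    then have "1 * t \<le> e * pi * t" using t by (intro mult_right_mono) auto
    then show ?thesis using t by (intro powr_mono2') auto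
  qed
  consider "s \<le> t / 2" | "t / 2 < s" "s \<le> t" | "t < s" by linarith
  then have "norm (heat_defect h t s) \<le> heat_const DIM('a) * C * (min 1 (s / t) * ?p) \<and>
    Linf_le (heat_defect h t s) (heat_const DIM('a) * C * t powr (- ?d) * (min 1 (s / t) * ?p))"
  proof cases
    case 1
    then have eq: "heat_defect h t s = heat (t - s) (h s) - heat t (h s)" and m: "min 1 (s / t) = s / t"
      using t s by (auto simp: heat_defect_def min_def)
    have "norm (heat_defect h t s) \<le> heat_const DIM('a) * (s / t) * norm (h s)"
      unfolding eq by (rule norm_heat_diff_le[OF t s 1])
    also have "\<dots> \<le> heat_const DIM('a) * (s / t) * (C * ?p)"
      using norm_h[OF s] t s by (intro mult_left_mono) auto
    finally have n: "norm (heat_defect h t s) \<le> heat_const DIM('a) * C * (min 1 (s / t) * ?p)" by (simp only: m mult_ac)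
    have "heat_const DIM('a) * (s / t) * (8 * pi * t) powr (- ?d) * norm (h s) \<le> heat_const DIM('a) * (s / t) * t powr (- ?d) * (C * ?p)"
      using norm_h[OF s] t s small[of 8] C_nonneg by (intro mult_mono mult_left_mono) auto
    then have "Linf_le (heat_defect h t s) (heat_const DIM('a) * (s / t) * t powr (- ?d) * (C * ?p))"
      using Linf_le_heat_diff[OF t s 1, of "h s"] unfolding eq by (rule Linf_le_mono[rotated])
    then show ?thesis using n by (simp only: m mult_ac) 
  next
    case 2
    \<comment> \<open>Here the factor \<open>min 1 (s / t)\<close> can be inserted into the trivial
      bound at the cost of a factor \<open>2\<close>.\<close>
    then have m: "1 / 2 \<le> min 1 (s / t)" using t by (simp add: field_simps)
    have "2 * C * ?p \<le> heat_const DIM('a) * C * (min 1 (s / t) * ?p)"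
    proof -
      have "2 \<le> heat_const DIM('a) * min 1 (s / t)" using mult_mono[OF heat_const_ge(2) m] t s by auto
      then have "2 * (C * ?p) \<le> heat_const DIM('a) * min 1 (s / t) * (C * ?p)" using C_nonneg by (intro mult_right_mono) auto
      then show ?thesis by (simp only: mult_ac)
    qed
    then have n: "norm (heat_defect h t s) \<le> heat_const DIM('a) * C * (min 1 (s / t) * ?p)"
      using heat_defect_le_trivial(1)[OF s, of t] by linarith
    have "2 * C * (1 + s) powr (- 1 - a - ?d) = 2 * C * ?p * (1 + s) powr (- ?d)"
      using powr_add[of "1 + s" "- 1 - a" "- ?d"] by simp
    also have "\<dots> \<le> 2 * C * ?p * (t / 2) powr (- ?d)"
      using 2 t C_nonneg by (intro mult_left_mono powr_mono2') auto
    also have "(t / 2) powr (- ?d) = 2 powr ?d * t powr (- ?d)"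
      using t by (simp add: powr_divide powr_minus field_simps)
    also have "2 * C * ?p * (2 powr ?d * t powr (- ?d)) = (2 * 2 powr ?d) * (C * ?p * t powr (- ?d))" by simp
    also have "\<dots> \<le> heat_const DIM('a) * min 1 (s / t) * (C * ?p * t powr (- ?d))"
      using mult_mono[OF heat_const_ge(1) m] C_nonneg t s by (intro mult_right_mono) auto
    finally have "2 * C * (1 + s) powr (- 1 - a - ?d) \<le> heat_const DIM('a) * C * t powr (- ?d) * (min 1 (s / t) * ?p)"
      by (simp only: mult_ac)
    then show ?thesis using n heat_defect_le_trivial(2)[OF s, of t] by (blast intro: Linf_le_mono)
  next
    case 3
    then have eq: "heat_defect h t s = 0 - heat t (h s)" and m: "min 1 (s / t) = 1"
      using t by (auto simp: heat_defect_def)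
    have "norm (heat_defect h t s) \<le> 1 * (C * ?p)"
      using norm_heat_le[of t "h s"] norm_h[OF s] unfolding eq by simp
    also have "\<dots> \<le> heat_const DIM('a) * (C * ?p)" using heat_const_ge(2) C_nonneg by (intro mult_right_mono) auto
    finally have n: "norm (heat_defect h t s) \<le> heat_const DIM('a) * C * (min 1 (s / t) * ?p)" by (simp add: m mult.assoc)
    have "0 + (4 * pi * t) powr (- ?d) * norm (h s) \<le> 1 * (t powr (- ?d) * (C * ?p))"
      using norm_h[OF s] small[of 4] by (auto intro: mult_mono)
    also have "\<dots> \<le> heat_const DIM('a) * (t powr (- ?d) * (C * ?p))" using heat_const_ge(2) C_nonneg by (intro mult_right_mono) auto
    finally have "Linf_le (heat_defect h t s) (heat_const DIM('a) * (t powr (- ?d) * (C * ?p)))"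
      unfolding eq by (rule Linf_le_mono[OF Linf_le_diff[OF Linf_le_zero Linf_le_heat_smoothing[OF t]]])
    then show ?thesis using n by (simp only: m mult_ac mult_1_left mult_1_right)
  qed
  then show "norm (heat_defect h t s) \<le> heat_const DIM('a) * C * (min 1 (s / t) * ?p)"
    and "Linf_le (heat_defect h t s) (heat_const DIM('a) * C * t powr (- ?d) * (min 1 (s / t) * ?p))" by auto
qed

text \<open>The pointwise bounds are integrated in \<open>s\<close>: the trivial ones give
  boundedness at all times, the weighted ones the rate from time one on.\<close>

lemma decays_heat_defect:
  "decays a (\<lambda>t. (LINT s:{0..t}|lborel. heat (t - s) (h s)) - heat t (LINT s:{0..}|lborel. h s))"
proof -
  let ?d = "DIM('a) / 2"
  let ?D = "\<lambda>t. (LINT s:{0..t}|lborel. heat (t - s) (h s)) - heat t (LINT s:{0..}|lborel. h s)"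
  let ?J = "\<lambda>t. (LINT s:{0..}|lborel. min 1 (s / t) * (1 + s) powr (- 1 - a))"
  define A where "A = (LINT s:{0..}|lborel. 2 * C * (1 + s) powr (- 1 - a))"
  obtain B where B: "B > 0" "\<And>t. t \<ge> 1 \<Longrightarrow> ?J t \<le> B * rate a t"
    using integral_min_powr_le[OF a_pos] by metis
  have int2: "set_integrable lborel {0..} (\<lambda>s::real. 2 * C * (1 + s) powr (- 1 - a))"
    using set_integrable_powr_Ici[OF a_pos] by simp
  have triv: "norm (?D t) \<le> A" "Linf_le (?D t) A" for t
    unfolding heat_defect_integral A_def
  proof -
    show "norm (LINT s:{0..}|lborel. heat_defect h t s) \<le> (LINT s:{0..}|lborel. 2 * C * (1 + s) powr (- 1 - a))"
      by (rule norm_set_integral_le[OF set_integrable_heat_defect int2]) (simp add: heat_defect_le_trivial(1))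
    show "Linf_le (LINT s:{0..}|lborel. heat_defect h t s) (LINT s:{0..}|lborel. 2 * C * (1 + s) powr (- 1 - a))"
    proof (rule Linf_le_set_integral[OF set_integrable_heat_defect int2])
      fix s :: real assume s: "s \<in> {0..}"
      then have "2 * C * (1 + s) powr (- 1 - a - ?d) \<le> 2 * C * (1 + s) powr (- 1 - a)"
        using C_nonneg by (intro mult_left_mono powr_mono) auto
      then show "Linf_le (heat_defect h t s) (2 * C * (1 + s) powr (- 1 - a))"
        using heat_defect_le_trivial(2)[of s t] s by (auto intro: Linf_le_mono)
    qed
  qed
  have large: "norm (?D t) \<le> heat_const DIM('a) * C * B * rate a t" "Linf_le (?D t) (heat_const DIM('a) * C * B * rate a t * t powr (- ?d))" if t: "t \<ge> 1" for t
    unfolding heat_defect_integral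
  proof -
    have int: "set_integrable lborel {0..} (\<lambda>s::real. e * (min 1 (s / t) * (1 + s) powr (- 1 - a)))" for e
      using set_integrable_min_powr[OF a_pos, of t] t by (intro set_integrable_mult_right) auto
    have "norm (LINT s:{0..}|lborel. heat_defect h t s) \<le>
        (LINT s:{0..}|lborel. heat_const DIM('a) * C * (min 1 (s / t) * (1 + s) powr (- 1 - a)))"
      using t by (intro norm_set_integral_le set_integrable_heat_defect int heat_defect_le) auto
    also have "\<dots> = heat_const DIM('a) * C * ?J t" by (rule set_integral_mult_right)
    also have "\<dots> \<le> heat_const DIM('a) * C * (B * rate a t)" using B(2)[OF t] C_nonneg by (intro mult_left_mono) auto
    finally show "norm (LINT s:{0..}|lborel. heat_defect h t s) \<le> heat_const DIM('a) * C * B * rate a t" by (simp add: mult.assoc)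
    have "Linf_le (LINT s:{0..}|lborel. heat_defect h t s)
        (LINT s:{0..}|lborel. heat_const DIM('a) * C * t powr (- ?d) * (min 1 (s / t) * (1 + s) powr (- 1 - a)))"
      using t by (intro Linf_le_set_integral set_integrable_heat_defect int heat_defect_le) auto
    also have "(LINT s:{0..}|lborel. heat_const DIM('a) * C * t powr (- ?d) * (min 1 (s / t) * (1 + s) powr (- 1 - a))) =
        heat_const DIM('a) * C * t powr (- ?d) * ?J t" by (rule set_integral_mult_right)
    finally show "Linf_le (LINT s:{0..}|lborel. heat_defect h t s) (heat_const DIM('a) * C * B * rate a t * t powr (- ?d))"
    proof (rule Linf_le_mono)
      have "heat_const DIM('a) * C * t powr (- ?d) * ?J t \<le> heat_const DIM('a) * C * t powr (- ?d) * (B * rate a t)"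
        using B(2)[OF t] C_nonneg by (intro mult_left_mono) auto
      then show "heat_const DIM('a) * C * t powr (- ?d) * ?J t \<le> heat_const DIM('a) * C * B * rate a t * t powr (- ?d)" by (simp only: mult_ac)
    qed
  qed
  show ?thesis
    unfolding decays_def
  proof (intro exI[of _ "max A (heat_const DIM('a) * C * B)"] conjI allI impI)
    fix t :: real
    show "norm (?D t) \<le> max A (heat_const DIM('a) * C * B)" using triv(1)[of t] by linarith
    show "Linf_le (?D t) (max A (heat_const DIM('a) * C * B))" using triv(2)[of t] by (rule Linf_le_mono) simp
    assume t: "t \<ge> 1"
    have le: "heat_const DIM('a) * C * B * rate a t \<le> max A (heat_const DIM('a) * C * B) * rate a t"
      using rate_pos[OF t, of a] by (intro mult_right_mono) auto
    then show "norm (?D t) \<le> max A (heat_const DIM('a) * C * B) * rate a t" using large(1)[OF t] by linarith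
    show "Linf_le (?D t) (max A (heat_const DIM('a) * C * B) * rate a t * t powr (- ?d))"
      using large(2)[OF t] by (rule Linf_le_mono) (intro mult_right_mono le, simp)
  qed
qed

end

section \<open>One step of the iteration\<close>

context power_nonlinearity
begin

text \<open>The definition of \<sigma> says \<open>DIM('a) / 2 * (p - 1) = 1 + \<sigma>\<close>.
  Hence the Lipschitz constant at time \<open>s\<close> is of order
  \<open>(1 + s) powr (- 1 - \<sigma>)\<close>, and it multiplies the decay of the
  difference.\<close>

lemma
  fixes v w :: "'a::euclidean_space L1"
  assumes s: "s \<ge> 0" and M: "M \<ge> 0"
    and v: "Linf_le v (M * (1 + s) powr (- (DIM('a) / 2)))"
    and w: "Linf_le w (M * (1 + s) powr (- (DIM('a) / 2)))"
    and \<sigma>: "\<sigma> = DIM('a) / 2 * (p - 1) - 1"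
  shows norm_nemytskii_decay: "norm (v - w) \<le> E * (1 + s) powr (- b) \<Longrightarrow>
      norm (nemytskii f v - nemytskii f w) \<le> 2 * K * M powr (p - 1) * E * (1 + s) powr (- 1 - (\<sigma> + b))"
    and Linf_le_nemytskii_decay: "Linf_le (v - w) (E * (1 + s) powr (- b - DIM('a) / 2)) \<Longrightarrow>
      Linf_le (nemytskii f v - nemytskii f w)
        (2 * K * M powr (p - 1) * E * (1 + s) powr (- 1 - (\<sigma> + b) - DIM('a) / 2))"
proof -
  have pw: "(M * (1 + s) powr (- (DIM('a) / 2))) powr (p - 1) = M powr (p - 1) * (1 + s) powr (- 1 - \<sigma>)"
    using s M by (simp add: powr_mult powr_powr \<sigma> algebra_simps)
  have eq: "2 * K * (M powr (p - 1) * (1 + s) powr (- 1 - \<sigma>)) * (E * (1 + s) powr e) =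
      2 * K * M powr (p - 1) * E * (1 + s) powr (- 1 - \<sigma> + e)" for e
    by (simp add: powr_add)
  have K: "0 \<le> 2 * K * (M powr (p - 1) * (1 + s) powr (- 1 - \<sigma>))" using K_pos by simp
  show "norm (nemytskii f v - nemytskii f w) \<le> 2 * K * M powr (p - 1) * E * (1 + s) powr (- 1 - (\<sigma> + b))"
    if "norm (v - w) \<le> E * (1 + s) powr (- b)"
    using order_trans[OF norm_nemytskii_diff_le[OF v w, unfolded pw] mult_left_mono[OF that K]]
    unfolding eq by (simp add: diff_diff_eq)
  show "Linf_le (nemytskii f v - nemytskii f w)
        (2 * K * M powr (p - 1) * E * (1 + s) powr (- 1 - (\<sigma> + b) - DIM('a) / 2))"
    if "Linf_le (v - w) (E * (1 + s) powr (- b - DIM('a) / 2))"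
    using Linf_le_nemytskii_diff[OF v w that] unfolding pw eq
    by (simp add: diff_diff_eq add_diff_eq)
qed

lemma decaying_source_nemytskii_diff:
  fixes v w :: "real \<Rightarrow> 'a::euclidean_space L1"
  assumes M: "M \<ge> 0" and \<sigma>: "\<sigma> = DIM('a) / 2 * (p - 1) - 1" and a: "\<sigma> + b > 0" and E: "E \<ge> 0"
    and meas: "v \<in> borel_measurable borel" "w \<in> borel_measurable borel"
    and neg: "\<And>s. s < 0 \<Longrightarrow> v s = 0" "\<And>s. s < 0 \<Longrightarrow> w s = 0"
    and v: "\<And>s. s \<ge> 0 \<Longrightarrow> Linf_le (v s) (M * (1 + s) powr (- (DIM('a) / 2)))"
    and w: "\<And>s. s \<ge> 0 \<Longrightarrow> Linf_le (w s) (M * (1 + s) powr (- (DIM('a) / 2)))"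
    and norm_diff: "\<And>s. s \<ge> 0 \<Longrightarrow> norm (v s - w s) \<le> E * (1 + s) powr (- b)"
    and Linf_diff: "\<And>s. s \<ge> 0 \<Longrightarrow> Linf_le (v s - w s) (E * (1 + s) powr (- b - DIM('a) / 2))"
  shows "decaying_source (\<lambda>s. nemytskii f (v s) - nemytskii f (w s)) (\<sigma> + b) (2 * K * M powr (p - 1) * E)"
proof
  \<comment> \<open>Measurability of the Nemytskii operator along a curve asks for one essential
    bound at all real times; this is why the curves vanish at negative times.\<close>
  have bound: "Linf_le (z s) M" if z: "\<And>s. s < 0 \<Longrightarrow> z s = 0"
      "\<And>s. s \<ge> 0 \<Longrightarrow> Linf_le (z s) (M * (1 + s) powr (- (DIM('a) / 2)))" for z :: "real \<Rightarrow> 'a L1" and s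
  proof (cases "s < 0")
    case True
    then show ?thesis using z(1) Linf_le_mono[OF Linf_le_zero M] by simp
  next
    case False
    have "(1 + s) powr (- (DIM('a) / 2)) \<le> (1 + s) powr 0" using False by (intro powr_mono) auto
    then have "M * (1 + s) powr (- (DIM('a) / 2)) \<le> M * 1" using M False by (intro mult_left_mono) auto
    then show ?thesis using z(2)[of s] False by (auto intro: Linf_le_mono)
  qed
  show "(\<lambda>s. nemytskii f (v s) - nemytskii f (w s)) \<in> borel_measurable borel"
    by (intro borel_measurable_diff measurable_nemytskii_bounded[OF meas(1) bound[OF neg(1) v]]
        measurable_nemytskii_bounded[OF meas(2) bound[OF neg(2) w]])
  show "2 * K * M powr (p - 1) * E \<ge> 0" using K_pos E by simp
  fix s :: real assume s: "s \<ge> 0"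
  show "norm (nemytskii f (v s) - nemytskii f (w s)) \<le>
      2 * K * M powr (p - 1) * E * (1 + s) powr (- 1 - (\<sigma> + b))"
    by (rule norm_nemytskii_decay[OF s M v[OF s] w[OF s] \<sigma> norm_diff[OF s]])
  show "Linf_le (nemytskii f (v s) - nemytskii f (w s))
      (2 * K * M powr (p - 1) * E * (1 + s) powr (- 1 - (\<sigma> + b) - DIM('a) / 2))"
    by (rule Linf_le_nemytskii_decay[OF s M v[OF s] w[OF s] \<sigma> Linf_diff[OF s]])
qed (rule a)

text \<open>Here \<open>w\<close> and \<open>w'\<close> stand for consecutive approximations.
  Measurability of \<open>w'\<close> belongs to the conclusion because the following step asks for
  it.\<close>

lemma decays_step:
  fixes u w :: "real \<Rightarrow> 'a::euclidean_space L1"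
  assumes \<sigma>: "\<sigma> = DIM('a) / 2 * (p - 1) - 1" "\<sigma> > 0" and c: "c \<ge> 0"
    and meas: "u \<in> borel_measurable borel" "w \<in> borel_measurable borel"
    and neg: "\<And>s. s < 0 \<Longrightarrow> u s = 0" "\<And>s. s < 0 \<Longrightarrow> w s = 0"
    and u: "decays 0 u" and D: "decays c (\<lambda>t. u t - w t)"
    and u_eq: "\<And>t. t \<ge> 0 \<Longrightarrow> u t = heat t \<phi> + (LINT s:{0..t}|lborel. heat (t - s) (nemytskii f (u s)))"
    and w'_eq: "\<And>t. t \<ge> 0 \<Longrightarrow> w' t = heat t (\<phi> + (LINT s:{0..}|lborel. nemytskii f (u s) - nemytskii f (w s))) +
       (LINT s:{0..t}|lborel. heat (t - s) (nemytskii f (w s)))"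
    and w'_neg: "\<And>t. t < 0 \<Longrightarrow> w' t = 0"
  shows "w' \<in> borel_measurable borel \<and> decays (\<sigma> + c) (\<lambda>t. u t - w' t)"
proof -
  let ?d = "DIM('a) / 2"
  obtain b E where b: "b \<ge> 0" "E > 0" "rate (\<sigma> + b) = rate (\<sigma> + c)"
    and E: "\<And>t. t \<ge> 0 \<Longrightarrow> norm (u t - w t) \<le> E * (1 + t) powr (- b)"
      "\<And>t. t \<ge> 0 \<Longrightarrow> Linf_le (u t - w t) (E * (1 + t) powr (- b - ?d))"
    using decays_imp_powr[OF D \<sigma>(2) c] by blast
  obtain b0 A where b0: "b0 \<ge> 0" "A > 0" "rate (\<sigma> + b0) = rate (\<sigma> + 0)"
    and A: "\<And>t. t \<ge> 0 \<Longrightarrow> norm (u t) \<le> A * (1 + t) powr (- b0)"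
      "\<And>t. t \<ge> 0 \<Longrightarrow> Linf_le (u t) (A * (1 + t) powr (- b0 - ?d))"
    using decays_imp_powr[OF u \<sigma>(2) order_refl] by blast
  define M where "M = A + E"
  have M: "M \<ge> 0" using b0 b by (simp add: M_def)
  have mono: "e * (1 + s) powr (- b - r) \<le> e * (1 + s) powr (- r)" "e * (1 + s) powr (- b) \<le> e"
    if "e > 0" "b \<ge> 0" "s \<ge> 0" for e b s r :: real
  proof -
    show "e * (1 + s) powr (- b - r) \<le> e * (1 + s) powr (- r)"
      using that by (intro mult_left_mono powr_mono) auto
    have "(1 + s) powr (- b) \<le> (1 + s) powr 0" using that by (intro powr_mono) auto
    then show "e * (1 + s) powr (- b) \<le> e" using that by simp
  qed
  have u0: "norm (u s) \<le> A" "Linf_le (u s) (A * (1 + s) powr (- ?d))" if "s \<ge> 0" for s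
    by (rule order_trans[OF A(1)[OF that] mono(2)[OF b0(2,1) that]],
        rule Linf_le_mono[OF A(2)[OF that] mono(1)[OF b0(2,1) that]])
  have D0: "norm (u s - w s) \<le> E" "Linf_le (u s - w s) (E * (1 + s) powr (- ?d))" if "s \<ge> 0" for s
    by (rule order_trans[OF E(1)[OF that] mono(2)[OF b(2,1) that]],
        rule Linf_le_mono[OF E(2)[OF that] mono(1)[OF b(2,1) that]])
  have uM: "norm (u s) \<le> M" "Linf_le (u s) (M * (1 + s) powr (- ?d))" if "s \<ge> 0" for s
  proof -
    have "A \<le> M" using b by (simp add: M_def)
    then show "norm (u s) \<le> M" using u0(1)[OF that] by linarith
    show "Linf_le (u s) (M * (1 + s) powr (- ?d))"
      by (rule Linf_le_mono[OF u0(2)[OF that] mult_right_mono[OF \<open>A \<le> M\<close>]]) simp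
  qed
  \<comment> \<open>The approximation inherits the decay of \<open>u\<close> by writing
    \<open>w = u - (u - w)\<close>.\<close>
  have wM: "norm (w s) \<le> M" "Linf_le (w s) (M * (1 + s) powr (- ?d))" if "s \<ge> 0" for s
  proof -
    show "norm (w s) \<le> M"
      using norm_triangle_ineq4[of "u s" "u s - w s"] u0(1)[OF that] D0(1)[OF that] by (simp add: M_def)
    show "Linf_le (w s) (M * (1 + s) powr (- ?d))"
      using Linf_le_diff[OF u0(2)[OF that] D0(2)[OF that]] by (simp add: M_def distrib_right)
  qed
  have zM: "Linf_le (0 :: 'a L1) (M * (1 + s) powr (- ?d))" for s
    using M by (intro Linf_le_mono[OF Linf_le_zero]) simp
  have nz: "nemytskii f 0 = (0 :: 'a L1)" by (rule nemytskii_zero[OF f_measurable f_0])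
  \<comment> \<open>Comparison with the zero curve gives source bounds for the two nonlinear terms
    separately, and so the integrability with which the integral of their difference is
    split.\<close>
  have "decaying_source (\<lambda>s. nemytskii f (u s) - nemytskii f 0) (\<sigma> + 0) (2 * K * M powr (p - 1) * M)"
    using \<sigma> by (intro decaying_source_nemytskii_diff meas neg) (auto simp: uM zM M)
  then interpret gu: decaying_source "\<lambda>s. nemytskii f (u s)" \<sigma> "2 * K * M powr (p - 1) * M"
    by (simp add: nz)
  have "decaying_source (\<lambda>s. nemytskii f (w s) - nemytskii f 0) (\<sigma> + 0) (2 * K * M powr (p - 1) * M)"
    using \<sigma> by (intro decaying_source_nemytskii_diff meas neg) (auto simp: wM zM M)
  then interpret gw: decaying_source "\<lambda>s. nemytskii f (w s)" \<sigma> "2 * K * M powr (p - 1) * M"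
    by (simp add: nz)
  interpret h: decaying_source "\<lambda>s. nemytskii f (u s) - nemytskii f (w s)" "\<sigma> + b" "2 * K * M powr (p - 1) * E"
    using \<sigma> b by (intro decaying_source_nemytskii_diff meas neg) (auto simp: uM wM M E)
  let ?\<Phi> = "\<phi> + (LINT s:{0..}|lborel. nemytskii f (u s) - nemytskii f (w s))"
  have [measurable]: "(\<lambda>s. nemytskii f (w s)) \<in> borel_measurable borel" by (rule gw.h_measurable)
  \<comment> \<open>The upper limit \<open>t\<close> is moved into the integrand, so that
    measurability of parameter integrals applies.\<close>
  have "(\<lambda>t. if t < 0 then 0 else heat t ?\<Phi> +
      (LINT s|lborel. (if 0 \<le> s \<and> s \<le> t then heat (t - s) (nemytskii f (w s)) else 0))) \<in> borel_measurable borel"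
    by measurable
  also have "(\<lambda>t. if t < 0 then 0 else heat t ?\<Phi> +
      (LINT s|lborel. (if 0 \<le> s \<and> s \<le> t then heat (t - s) (nemytskii f (w s)) else 0))) = w'"
  proof
    fix t :: real
    have "(LINT s:{0..t}|lborel. heat (t - s) (nemytskii f (w s))) =
        (LINT s|lborel. (if 0 \<le> s \<and> s \<le> t then heat (t - s) (nemytskii f (w s)) else 0))"
      unfolding set_lebesgue_integral_def
      by (rule Bochner_Integration.integral_cong) (auto simp: indicator_def)
    then show "(if t < 0 then 0 else heat t ?\<Phi> +
      (LINT s|lborel. (if 0 \<le> s \<and> s \<le> t then heat (t - s) (nemytskii f (w s)) else 0))) = w' t"
      using w'_eq[of t] w'_neg[of t] by auto
  qed
  finally have 1: "w' \<in> borel_measurable borel" .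
  have eq: "u t - w' t = (LINT s:{0..t}|lborel. heat (t - s) (nemytskii f (u s) - nemytskii f (w s))) -
      heat t (LINT s:{0..}|lborel. nemytskii f (u s) - nemytskii f (w s))" if t: "t \<ge> 0" for t
  proof -
    have "(LINT s:{0..t}|lborel. heat (t - s) (nemytskii f (u s) - nemytskii f (w s))) =
        (LINT s:{0..t}|lborel. heat (t - s) (nemytskii f (u s)) - heat (t - s) (nemytskii f (w s)))"
      by (simp add: linear_diff[OF bounded_linear.linear[OF bounded_linear_heat]])
    also have "\<dots> = (LINT s:{0..t}|lborel. heat (t - s) (nemytskii f (u s))) -
        (LINT s:{0..t}|lborel. heat (t - s) (nemytskii f (w s)))"
      by (rule set_integral_diff(2)[OF gu.set_integrable_heat_Icc gw.set_integrable_heat_Icc])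
    finally show ?thesis
      by (simp add: u_eq[OF t] w'_eq[OF t] linear_add[OF bounded_linear.linear[OF bounded_linear_heat]])
  qed
  \<comment> \<open>The exponent \<open>b\<close> may be smaller than \<open>c\<close>, but the
    rates at \<open>\<sigma> + b\<close> and \<open>\<sigma> + c\<close> coincide.\<close>
  have "decays (\<sigma> + c) (\<lambda>t. u t - w' t)"
    by (rule iffD2[OF decays_cong[OF b(3)[symmetric]] h.decays_heat_defect]) (rule eq)
  with 1 show ?thesis by blast
qed

end

section \<open>The asymptotic expansion\<close>

lemma ennreal_mult_le_imp_le:
  assumes "ennreal c * x \<le> ennreal S" "c > 0"
  shows "x \<le> ennreal (S / c)"
proof -
  have "ennreal (1 / c) * ennreal c * x \<le> ennreal (1 / c) * ennreal S"
    using assms(1) by (subst mult.assoc) (rule mult_left_mono, auto)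
  moreover have "ennreal (1 / c) * ennreal c = 1"
    using assms(2) by (subst ennreal_mult[symmetric]) auto
  moreover have "ennreal (1 / c) * ennreal S = ennreal (S / c)"
    using assms(2) by (subst ennreal_mult'[symmetric]) auto
  ultimately show ?thesis by simp
qed

text \<open>Only the endpoints \<open>q = 1\<close> and \<open>q = \<infinity>\<close> of the
  supremum are read off.\<close>

lemma decays_zero_of_SUP_Lq_norm:
  fixes v :: "real \<Rightarrow> 'a::euclidean_space L1"
  assumes "(SUP q\<in>{1..}. SUP t\<in>{0..}.
      ennreal ((1 + t) powr (DIM('a) / 2 * (1 - enn2real (inverse q)))) * Lq_norm q (v t)) < \<infinity>"
  shows "decays 0 v"
proof -
  let ?F = "\<lambda>q t. ennreal ((1 + t) powr (DIM('a) / 2 * (1 - enn2real (inverse q)))) * Lq_norm q (v t)"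
  define S where "S = enn2real (SUP q\<in>{1..}. SUP t\<in>{0..}. ?F q t)"
  have S: "S \<ge> 0" "(SUP q\<in>{1..}. SUP t\<in>{0..}. ?F q t) = ennreal S"
    using assms unfolding S_def infinity_ennreal_def by (simp_all only: ennreal_enn2real enn2real_nonneg)
  have le: "?F q t \<le> ennreal S" if "q \<ge> 1" "t \<ge> 0" for q t
  proof -
    have "?F q t \<le> (SUP t\<in>{0..}. ?F q t)" using that by (intro SUP_upper) simp
    also have "\<dots> \<le> ennreal S" unfolding S(2)[symmetric] using that by (intro SUP_upper) simp
    finally show ?thesis .
  qed
  have 1: "norm (v t) \<le> S" if t: "t \<ge> 0" for t
    using le[of 1 t] t S(1) by (simp add: Lq_norm_1)
  have inf: "Linf_le (v t) (S * (1 + t) powr (- (DIM('a) / 2)))" if t: "t \<ge> 0" for t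
  proof -
    have "Lq_norm \<infinity> (v t) \<le> ennreal (S / (1 + t) powr (DIM('a) / 2))"
      by (rule ennreal_mult_le_imp_le) (use le[of \<infinity> t] t in simp_all)
    then have "Linf_le (v t) (S / (1 + t) powr (DIM('a) / 2))"
      using Lq_norm_infinity_le_iff[of "S / (1 + t) powr (DIM('a) / 2)" "v t"] S(1) by simp
    then show ?thesis by (simp add: powr_minus_divide)
  qed
  show ?thesis
    unfolding decays_def
  proof (intro exI[of _ S] conjI allI impI)
    fix t :: real
    show "norm (v t) \<le> S" if "t \<ge> 0" using 1 that .
    show "Linf_le (v t) S" if t: "t \<ge> 0"
    proof (rule Linf_le_mono[OF inf[OF t]])
      have "(1 + t) powr (- (DIM('a) / 2)) \<le> (1 + t) powr 0" using t by (intro powr_mono) auto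
      then show "S * (1 + t) powr (- (DIM('a) / 2)) \<le> S" using t S(1) by (intro mult_left_le) auto
    qed
    assume t: "t \<ge> 1"
    show "norm (v t) \<le> S * rate 0 t" using 1[of t] t by (simp add: rate_def)
    show "Linf_le (v t) (S * rate 0 t * t powr (- (DIM('a) / 2)))"
    proof (rule Linf_le_mono[OF inf])
      have "(1 + t) powr (- (DIM('a) / 2)) \<le> t powr (- (DIM('a) / 2))" using t by (intro powr_mono2') auto
      then show "S * (1 + t) powr (- (DIM('a) / 2)) \<le> S * rate 0 t * t powr (- (DIM('a) / 2))"
        using t S(1) by (simp add: rate_def mult_left_mono)
    qed (use t in simp)
  qed
qed

text \<open>The endpoint bounds differ by \<open>t powr (- (DIM('a) / 2))\<close>, so interpolation
  produces the power \<open>1 - 1 / q\<close> of this factor, which the weight cancels.\<close>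

lemma decays_imp_Lq:
  fixes D :: "real \<Rightarrow> 'a::euclidean_space L1"
  assumes "decays c D" and q: "q \<ge> 1"
  obtains C where "C > 0" "\<And>t. t \<ge> 1 \<Longrightarrow>
    ennreal (t powr (DIM('a) / 2 * (1 - enn2real (inverse q)))) * Lq_norm q (D t) \<le> ennreal (C * rate c t)"
proof -
  let ?d = "DIM('a) / 2"
  let ?r = "enn2real (inverse q)"
  obtain B where B0: "\<And>t. t \<ge> 0 \<Longrightarrow> norm (D t) \<le> B"
    and B: "\<And>t. t \<ge> 1 \<Longrightarrow> norm (D t) \<le> B * rate c t"
      "\<And>t. t \<ge> 1 \<Longrightarrow> Linf_le (D t) (B * rate c t * t powr (- ?d))"
    using assms(1) unfolding decays_def by blast
  have "B \<ge> 0" using B0[of 0] norm_ge_zero order_trans by blast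
  show ?thesis
  \<comment> \<open>The bound \<open>B\<close> may be zero, whereas a positive constant is
    demanded.\<close>
  proof (rule that[of "B + 1"])
    show "B + 1 > 0" using \<open>B \<ge> 0\<close> by simp
    fix t :: real assume t: "t \<ge> 1"
    define R where "R = B * rate c t"
    have R: "R \<ge> 0" using \<open>B \<ge> 0\<close> rate_pos[OF t, of c] by (simp add: R_def)
    have "Lq_norm q (D t) \<le> ennreal (R powr ?r * (R * t powr (- ?d)) powr (1 - ?r))"
      unfolding R_def by (rule Lq_norm_interpolation[OF q B(1)[OF t] B(2)[OF t]])
    also have "R powr ?r * (R * t powr (- ?d)) powr (1 - ?r) = R * t powr (- (?d * (1 - ?r)))"
    proof (cases "R = 0")
      case False
      then have "R powr ?r * R powr (1 - ?r) = R" using R by (simp add: powr_add[symmetric])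
      moreover have "(R * t powr (- ?d)) powr (1 - ?r) = R powr (1 - ?r) * t powr (- (?d * (1 - ?r)))"
        using R by (simp add: powr_mult powr_powr)
      ultimately show ?thesis by (simp add: mult.assoc[symmetric])
    qed simp
    finally have "ennreal (t powr (?d * (1 - ?r))) * Lq_norm q (D t) \<le>
        ennreal (t powr (?d * (1 - ?r))) * ennreal (R * t powr (- (?d * (1 - ?r))))"
      by (rule mult_left_mono) simp
    also have "\<dots> = ennreal (t powr (?d * (1 - ?r)) * (R * t powr (- (?d * (1 - ?r)))))"
      using R by (simp add: ennreal_mult)
    also have "t powr (?d * (1 - ?r)) * (R * t powr (- (?d * (1 - ?r)))) = R"
      using t by (simp add: powr_minus)
    also have "ennreal R \<le> ennreal ((B + 1) * rate c t)"
      unfolding R_def using rate_pos[OF t, of c] by (intro ennreal_leI mult_right_mono) auto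
    finally show "ennreal (t powr (?d * (1 - ?r))) * Lq_norm q (D t) \<le> ennreal ((B + 1) * rate c t)" .
  qed
qed

theorem theorem1p3:
  fixes f :: "real \<Rightarrow> real" and K p n \<sigma> \<epsilon>0 :: real
    and \<phi> :: "(real ^ 'n) L1" and u :: "real \<Rightarrow> (real ^ 'n) L1"
    and \<Phi> :: "nat \<Rightarrow> (real ^ 'n) L1" and U :: "nat \<Rightarrow> real \<Rightarrow> (real ^ 'n) L1"
  assumes n: "n = real CARD('n)"
    and f_0: "f 0 = 0" and K: "K > 0" and p_gt_1: "p > 1"
    and f_lip: "\<And>\<xi> \<eta>. \<bar>f \<xi> - f \<eta>\<bar> \<le> K * (\<bar>\<xi>\<bar> powr (p - 1) + \<bar>\<eta>\<bar> powr (p - 1)) * \<bar>\<xi> - \<eta>\<bar>"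
    and p_gt_Fujita: "p > 1 + 2 / n"
    and \<epsilon>0_pos: "\<epsilon>0 > 0"
    and \<epsilon>0: "\<And>\<psi> :: (real ^ 'n) L1.
      Lq_norm \<infinity> \<psi> < \<infinity> \<Longrightarrow> Lq_norm 1 \<psi> + Lq_norm \<infinity> \<psi> \<le> ennreal \<epsilon>0 \<Longrightarrow>
      \<exists>v. global_solution f \<psi> v \<and>
          (\<forall>w. global_solution f \<psi> w \<longrightarrow> (\<forall>t\<ge>0. w t = v t)) \<and>
          (SUP q\<in>{1..}. SUP t\<in>{0..}.
             ennreal ((1 + t) powr (n / 2 * (1 - enn2real (inverse q)))) * Lq_norm q (v t)) < \<infinity>"
    and \<phi>_bounded: "Lq_norm \<infinity> \<phi> < \<infinity>"
    and \<phi>_small: "Lq_norm 1 \<phi> + Lq_norm \<infinity> \<phi> \<le> ennreal \<epsilon>0"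
    and u: "global_solution f \<phi> u"
    and \<sigma>: "\<sigma> = n / 2 * (p - 1) - 1"
    and \<Phi>_1: "\<Phi> 1 = \<phi> + (LINT s:{0..}|lborel. nemytskii f (u s))"
    and U_1: "\<And>t. t \<ge> 0 \<Longrightarrow> U 1 t = heat t (\<Phi> 1)"
    and \<Phi>_N: "\<And>N. N \<ge> 2 \<Longrightarrow>
      \<Phi> N = \<phi> + (LINT s:{0..}|lborel. nemytskii f (u s) - nemytskii f (U (N - 1) s))"
    and U_N: "\<And>N t. N \<ge> 2 \<Longrightarrow> t \<ge> 0 \<Longrightarrow>
      U N t = heat t (\<Phi> N) + (LINT s:{0..t}|lborel. heat (t - s) (nemytskii f (U (N - 1) s)))"
  shows "\<forall>N\<ge>1. \<forall>q\<ge>1. \<exists>C>0. \<forall>t>2 ^ (N - 1).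
    ennreal (t powr (n / 2 * (1 - enn2real (inverse q)))) * Lq_norm q (u t - U N t) \<le>
      ennreal (if 0 < N * \<sigma> \<and> N * \<sigma> < 1 then C * t powr (- (N * \<sigma>))
               else if N * \<sigma> = 1 then C * t powr (- 1) * ln (1 + t)
               else C * t powr (- 1))"
proof -
  interpret power_nonlinearity f K p
    using f_0 K p_gt_1 f_lip by unfold_locales
  have n_dim: "n = DIM(real ^ 'n)" using n by simp
  have "n > 0" using n by simp
  then have \<sigma>_pos: "\<sigma> > 0" using p_gt_Fujita by (simp add: \<sigma> field_simps)
  \<comment> \<open>The values of \<open>u\<close> at negative times are arbitrary; cutting them off
    gives a Borel curve on the whole line.\<close>
  define u0 where "u0 t = indicator {0..} t *\<^sub>R u t" for t
  have u0: "u0 t = u t" if "t \<ge> 0" for t using that by (simp add: u0_def)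
  have u0_neg: "u0 t = 0" if "t < 0" for t using that by (simp add: u0_def)
  have u0_meas: "u0 \<in> borel_measurable borel"
    using u unfolding u0_def[abs_def] global_solution_def space_X_def
    by (intro borel_measurable_continuous_on_indicator) auto
  obtain v where v: "\<forall>w. global_solution f \<phi> w \<longrightarrow> (\<forall>t\<ge>0. w t = v t)"
    and SUP: "(SUP q\<in>{1..}. SUP t\<in>{0..}.
             ennreal ((1 + t) powr (n / 2 * (1 - enn2real (inverse q)))) * Lq_norm q (v t)) < \<infinity>"
    using \<epsilon>0[OF \<phi>_bounded \<phi>_small] by blast
  have "decays 0 v" using decays_zero_of_SUP_Lq_norm[OF SUP[unfolded n_dim]] .
  \<comment> \<open>Uniqueness identifies \<open>u\<close> with the solution whose decay is given by
    the property of \<open>\<epsilon>0\<close>.\<close>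
  moreover have "u0 t = v t" if "t \<ge> 0" for t using v u u0 that by auto
  ultimately have u0_decays: "decays 0 u0"
    using decays_cong[of 0 0 u0 v] by simp
  have u0_eq: "u0 t = heat t \<phi> + (LINT s:{0..t}|lborel. heat (t - s) (nemytskii f (u0 s)))" if "t \<ge> 0" for t
  proof -
    have "(LINT s:{0..t}|lborel. heat (t - s) (nemytskii f (u s))) =
        (LINT s:{0..t}|lborel. heat (t - s) (nemytskii f (u0 s)))"
      by (rule set_lebesgue_integral_cong) (auto simp: u0)
    then show ?thesis using u that by (simp add: global_solution_def u0)
  qed
  have nz: "nemytskii f 0 = (0 :: (real ^ 'n) L1)" by (rule nemytskii_zero[OF f_measurable f_0])
  have heat0: "heat t 0 = (0 :: (real ^ 'n) L1)" for t
    by (rule linear_0[OF bounded_linear.linear[OF bounded_linear_heat]])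
  have \<sigma>': "\<sigma> = DIM(real ^ 'n) / 2 * (p - 1) - 1" using \<sigma> n_dim by simp
  \<comment> \<open>The recursion also holds from \<open>U 0 = 0\<close>, for which \<open>u - U 0\<close> decays at rate \<open>0 * \<sigma>\<close>.\<close>
  define W where "W N t = (if N = 0 \<or> t < 0 then 0 else U N t)" for N t
  have W_Suc: "W (Suc N) t = heat t (\<phi> + (LINT s:{0..}|lborel. nemytskii f (u0 s) - nemytskii f (W N s))) +
       (LINT s:{0..t}|lborel. heat (t - s) (nemytskii f (W N s)))" if t: "t \<ge> 0" for N t
  proof (cases "N = 0")
    case True
    have "(LINT s:{0..}|lborel. nemytskii f (u s)) = (LINT s:{0..}|lborel. nemytskii f (u0 s))"
      by (rule set_lebesgue_integral_cong) (auto simp: u0)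
    \<comment> \<open>Because \<open>nemytskii f 0 = 0\<close>, the general recursion at
      \<open>W 0 = 0\<close> reduces to the definitions of \<open>\<Phi> 1\<close> and
      \<open>U 1\<close>.\<close>
    then show ?thesis using True t U_1[OF t] \<Phi>_1 by (simp add: W_def nz heat0 set_lebesgue_integral_def)
  next
    case False
    have "(LINT s:{0..}|lborel. nemytskii f (u s) - nemytskii f (U N s)) =
        (LINT s:{0..}|lborel. nemytskii f (u0 s) - nemytskii f (W N s))"
      by (rule set_lebesgue_integral_cong) (use False in \<open>auto simp: u0 W_def\<close>)
    moreover have "(LINT s:{0..t}|lborel. heat (t - s) (nemytskii f (U N s))) =
        (LINT s:{0..t}|lborel. heat (t - s) (nemytskii f (W N s)))"
      by (rule set_lebesgue_integral_cong) (use False in \<open>auto simp: W_def\<close>)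
    ultimately show ?thesis
      using False t U_N[of "Suc N" t] \<Phi>_N[of "Suc N"] by (simp add: W_def)
  qed
  have W: "W N \<in> borel_measurable borel \<and> decays (N * \<sigma>) (\<lambda>t. u0 t - W N t)" for N
  proof (induction N)
    case 0
    have "W 0 = (\<lambda>t. 0)" by (simp add: W_def fun_eq_iff)
    then show ?case using u0_decays by simp
  next
    case (Suc N)
    have "W (Suc N) \<in> borel_measurable borel \<and> decays (\<sigma> + N * \<sigma>) (\<lambda>t. u0 t - W (Suc N) t)"
      by (rule decays_step[OF \<sigma>' \<sigma>_pos _ u0_meas _ u0_neg _ u0_decays _ u0_eq W_Suc])
        (use Suc \<sigma>_pos in \<open>auto simp: W_def\<close>)
    then show ?case by (simp add: algebra_simps)
  qed
  show ?thesis
  proof (intro allI impI)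
    fix N :: nat and q :: ennreal assume N: "N \<ge> 1" and q: "q \<ge> 1"
    obtain C where C: "C > 0" "\<And>t. t \<ge> 1 \<Longrightarrow>
        ennreal (t powr (n / 2 * (1 - enn2real (inverse q)))) * Lq_norm q (u0 t - W N t) \<le> ennreal (C * rate (N * \<sigma>) t)"
      using decays_imp_Lq[OF conjunct2[OF W[of N]] q] unfolding n_dim by blast
    show "\<exists>C>0. \<forall>t>2 ^ (N - 1).
      ennreal (t powr (n / 2 * (1 - enn2real (inverse q)))) * Lq_norm q (u t - U N t) \<le>
      ennreal (if 0 < N * \<sigma> \<and> N * \<sigma> < 1 then C * t powr (- (N * \<sigma>))
               else if N * \<sigma> = 1 then C * t powr (- 1) * ln (1 + t)
               else C * t powr (- 1))"
    proof (intro exI[of _ C] conjI allI impI C(1))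
      fix t :: real assume "t > 2 ^ (N - 1)"
      \<comment> \<open>The range of \<open>t\<close> in the claim lies in \<open>t \<ge> 1\<close>,
        where the rates apply.\<close>
      moreover have "(1::real) \<le> 2 ^ (N - 1)" by (rule one_le_power) simp
      ultimately have t: "t \<ge> 1" by linarith
      have "C * rate (N * \<sigma>) t = (if 0 < N * \<sigma> \<and> N * \<sigma> < 1 then C * t powr (- (N * \<sigma>))
               else if N * \<sigma> = 1 then C * t powr (- 1) * ln (1 + t)
               else C * t powr (- 1))"
        using N \<sigma>_pos by (auto simp: rate_def)
      then show "ennreal (t powr (n / 2 * (1 - enn2real (inverse q)))) * Lq_norm q (u t - U N t) \<le>
        ennreal (if 0 < N * \<sigma> \<and> N * \<sigma> < 1 then C * t powr (- (N * \<sigma>))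
               else if N * \<sigma> = 1 then C * t powr (- 1) * ln (1 + t)
               else C * t powr (- 1))"
        using C(2)[OF t] t N by (simp add: u0 W_def)
    qed
  qed
qed

end
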